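(* For any $s,k\in\mathbb{N}$ there are $r,m_0,N\in\mathbb{N}$ such that the following holds. If $m\ge m_0$, $n\ge N\log m$, and for $j=1,2$ we have $R_j\subset[n]$ with $|R_j|\le k$ and $(r,m^{-k})$-uncapturable families $\mathcal{A}_j\subset[m]^{[n]\setminus R_j}$, then there are $x^1\in\mathcal{A}_1$, $x^2\in\mathcal{A}_2$ with $|\{i\in[n]\setminus(R_1\cup R_2): x^1_i=x^2_i\}|=s$.
   Context: $\mu$ is the uniform probability measure on $[m]^I$. A dictator in $[m]^I$ is a set $\{x\in[m]^I:x_i=a\}$ with $i\in I$, $a\in[m]$. A family $\mathcal{G}\subset[m]^I$ is $(r,\varepsilon)$-capturable if there is a set of at most $r$ dictators whose union $U$ satisfies $\mu(\mathcal{G}\setminus U)\le\varepsilon$; otherwise it is $(r,\varepsilon)$-uncapturable. *)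

theory Defs
  imports "HOL-Analysis.Analysis"
begin

definition cube :: "nat \<Rightarrow> nat set \<Rightarrow> (nat \<Rightarrow> nat) set" where
  "cube m I = PiE I (\<lambda>_. {1..m})"

definition mu :: "nat \<Rightarrow> nat set \<Rightarrow> (nat \<Rightarrow> nat) set \<Rightarrow> real" where
  "mu m I G = real (card (G \<inter> cube m I)) / real (card (cube m I))"

definition dictators :: "nat \<Rightarrow> nat set \<Rightarrow> (nat \<Rightarrow> nat) set set" where
  "dictators m I = {{x \<in> cube m I. x i = a} | i a. i \<in> I \<and> a \<in> {1..m}}"

definition capturable :: "nat \<Rightarrow> nat set \<Rightarrow> nat \<Rightarrow> real \<Rightarrow> (nat \<Rightarrow> nat) set \<Rightarrow> bool" where
  "capturable m I r \<epsilon> G \<longleftrightarrow>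
     (\<exists>D. D \<subseteq> dictators m I \<and> finite D \<and> card D \<le> r \<and> mu m I (G - \<Union>D) \<le> \<epsilon>)"

definition uncapturable :: "nat \<Rightarrow> nat set \<Rightarrow> nat \<Rightarrow> real \<Rightarrow> (nat \<Rightarrow> nat) set \<Rightarrow> bool" where
  "uncapturable m I r \<epsilon> G \<longleftrightarrow> \<not> capturable m I r \<epsilon> G"

end

theory Submission
  imports Defs "HOL-Real_Asymp.Real_Asymp"
begin

text \<open>
  For \<open>s = 0\<close>, pass to fibres of the two families in which no single coordinate takes any value with
  probability more than about \<open>1 / sqrt m\<close>, and such that no agreement can occur on the coordinates fixed
  on the way; uncapturability allows the second family to avoid the values fixed for the first. Now reveal
  uniform elements \<open>x\<close> and \<open>y\<close> of the two fibres one coordinate at a time. Given the past, the two laws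
  \<open>q\<close> and \<open>q'\<close> of the next coordinate have an explicit coupling which never agrees at a symbol that is
  light (probability at most \<open>\<eta>\<close>) for both, and whose maximal correlation is \<open>O(\<eta>)\<close>. Maximal correlation
  tensorizes, so events about the two pasts stay almost independent. Since the density is at least
  \<open>m\<close> to a constant negative power, the chain rule for relative entropy bounds the total squared distance of
  the conditional laws from uniform by \<open>O(ln m)\<close>. Together this makes the expected number of agreements at
  heavy symbols \<open>o(1)\<close> for \<open>\<eta>\<close> the fourth root of \<open>1 / m\<close>.

  To gain one agreement, fix the same value \<open>a\<close> at the same coordinate \<open>i\<close> in both fibres. As there are many
  times \<open>ln m\<close> coordinates, most of them are nearly uniform and nearly independent of the coordinates
  before, and of those after, by the chain rule again; so for some \<open>i\<close> and \<open>a\<close> both restrictions have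
  lost little density and have no value of conditional probability above a small constant, hence remain
  uncapturable. Induction on \<open>s\<close> finishes the proof.
\<close>

declare One_nat_def [simp del]

section \<open>Sums over cubes\<close>

lemma finite_cube [simp]: "finite S \<Longrightarrow> finite (cube m S)"
  unfolding cube_def by (intro finite_PiE) auto

lemma card_cube: "finite S \<Longrightarrow> card (cube m S) = m ^ card S"
  unfolding cube_def by (simp add: card_PiE)

lemma cube_empty [simp]: "cube m {} = {\<lambda>_. undefined}"
  unfolding cube_def by simp

lemma sum_cube_insert:
  assumes "i \<notin> S"
  shows "(\<Sum>x\<in>cube m (insert i S). f x) = (\<Sum>x\<in>cube m S. \<Sum>a=1..m. f (x(i := a)))"
proof -
  let ?g = "\<lambda>(a, x). x(i := a)"
  have "inj_on ?g ({1..m} \<times> cube m S)"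
    using inj_combinator[OF assms, of "\<lambda>_. {1..m}"] unfolding cube_def .
  moreover have "cube m (insert i S) = ?g ` ({1..m} \<times> cube m S)"
    unfolding cube_def by (rule PiE_insert_eq)
  ultimately have "(\<Sum>x\<in>cube m (insert i S). f x) = (\<Sum>z\<in>{1..m} \<times> cube m S. f (?g z))"
    by (simp add: sum.reindex)
  also have "\<dots> = (\<Sum>a=1..m. \<Sum>x\<in>cube m S. f (x(i := a)))"
    by (simp add: sum.cartesian_product split_def)
  finally show ?thesis
    by (subst sum.swap)
qed

lemma restrict_insert_eq_iff:
  assumes "x \<in> cube m S" "i \<notin> S"
  shows "restrict y (insert i S) = x(i := a) \<longleftrightarrow> restrict y S = x \<and> y i = a"
proof -
  have x: "x j = undefined" if "j \<notin> S" for j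
    using assms(1) that unfolding cube_def by (auto simp: PiE_def extensional_def)
  show ?thesis
  proof
    assume eq: "restrict y (insert i S) = x(i := a)"
    have "restrict y S j = x j" for j
      using fun_cong[OF eq, of j] assms(2) x[of j] by (cases "j \<in> S") auto
    then show "restrict y S = x \<and> y i = a" using fun_cong[OF eq, of i] by auto
  next
    assume "restrict y S = x \<and> y i = a"
    then show "restrict y (insert i S) = x(i := a)" using assms(2) by (auto simp: fun_eq_iff)
  qed
qed

section \<open>An explicit coupling of two probability vectors\<close>

text \<open>Bias-variance decomposition. With \<open>c\<close> the mean it turns variances into
  centred second moments; with arbitrary \<open>c\<close> it bounds the variance by the second
  moment about \<open>c\<close>.\<close>

lemma sum_weighted_square_shift:
  fixes P F :: "'a \<Rightarrow> real"
  assumes "sum P X = 1"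
  shows "(\<Sum>x\<in>X. P x * (F x - c)\<^sup>2) = (\<Sum>x\<in>X. P x * (F x)\<^sup>2) - (\<Sum>x\<in>X. P x * F x)\<^sup>2 + ((\<Sum>x\<in>X. P x * F x) - c)\<^sup>2"
proof -
  have "(\<Sum>x\<in>X. P x * (F x - c)\<^sup>2) = (\<Sum>x\<in>X. P x * (F x)\<^sup>2 - 2 * c * (P x * F x) + c\<^sup>2 * P x)"
    by (intro sum.cong) (auto simp: power2_eq_square algebra_simps)
  also have "\<dots> = (\<Sum>x\<in>X. P x * (F x)\<^sup>2) - 2 * c * (\<Sum>x\<in>X. P x * F x) + c\<^sup>2 * sum P X"
    by (simp add: sum.distrib sum_subtractf sum_distrib_left)
  finally show ?thesis using assms by (simp add: power2_eq_square algebra_simps)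
qed

text \<open>The coupling is the product measure corrected by
  \<open>- (\<Sum>a. c a * (e\<^sub>a - q) (e\<^sub>a - q')\<^sup>T)\<close>, which leaves the marginals alone. The diagonal entry at a light
  symbol vanishes iff \<open>c a * (1 - q a - q' a) = q a * q' a * (1 - \<Sum>c)\<close>, and this is solved by the
  \<open>c\<close> below.\<close>

lemma off_diagonal_coupling:
  fixes q q' :: "'a \<Rightarrow> real" and \<eta> :: real
  assumes fin: "finite C"
    and q: "\<And>a. a \<in> C \<Longrightarrow> 0 \<le> q a" "sum q C = 1"
    and q': "\<And>a. a \<in> C \<Longrightarrow> 0 \<le> q' a" "sum q' C = 1"
    and \<eta>: "0 < \<eta>" "\<eta> \<le> 1/4"
  obtains J :: "'a \<Rightarrow> 'a \<Rightarrow> real" where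
    "\<And>a b. a \<in> C \<Longrightarrow> b \<in> C \<Longrightarrow> 0 \<le> J a b"
    "\<And>a. a \<in> C \<Longrightarrow> (\<Sum>b\<in>C. J a b) = q a"
    "\<And>b. b \<in> C \<Longrightarrow> (\<Sum>a\<in>C. J a b) = q' b"
    "\<And>a. a \<in> C \<Longrightarrow> J a a \<le> q a * q' a * (of_bool (\<eta> < q a) + of_bool (\<eta> < q' a))"
    "\<And>F G. (\<Sum>a\<in>C. \<Sum>b\<in>C. J a b * (F a * G b)) \<le> (\<Sum>a\<in>C. q a * F a) * (\<Sum>b\<in>C. q' b * G b)
       + \<eta> * ((\<Sum>a\<in>C. q a * (F a)\<^sup>2) - (\<Sum>a\<in>C. q a * F a)\<^sup>2
            + ((\<Sum>b\<in>C. q' b * (G b)\<^sup>2) - (\<Sum>b\<in>C. q' b * G b)\<^sup>2))"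
proof -
  define light where "light a \<longleftrightarrow> q a \<le> \<eta> \<and> q' a \<le> \<eta>" for a
  define w where "w a = (if light a then q a * q' a / (1 - q a - q' a) else 0)" for a
  define S where "S = sum w C"
  \<comment> \<open>The factor \<open>1 / (1 + S)\<close> gives \<open>c\<close> the sum
    \<open>K\<close>, and \<open>1 - K\<close> is that same factor, so the equation for
    \<open>c\<close>, in which its own sum occurs, reduces to the formula for
    \<open>w\<close>.\<close>
  define c where "c a = w a / (1 + S)" for a
  define K where "K = S / (1 + S)"
  define J where "J a b = q a * q' b * (1 - K) + c a * q' b + q a * c b - (if a = b then c a else 0)" for a b
  have w0: "0 \<le> w a" if "a \<in> C" for a
    using q(1)[OF that] q'(1)[OF that] \<eta> unfolding w_def light_def by (auto intro!: divide_nonneg_nonneg)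
  then have S0: "0 \<le> S" unfolding S_def by (intro sum_nonneg) auto
  then have K: "0 \<le> K" "1 - K = 1 / (1 + S)" unfolding K_def by (auto simp: field_simps)
  then have K1: "0 \<le> 1 - K" "1 - K \<le> 1" using S0 by auto
  have c0: "0 \<le> c a" if "a \<in> C" for a
    using w0[OF that] S0 unfolding c_def by auto
  have sumc: "sum c C = K" unfolding c_def K_def S_def by (simp add: sum_divide_distrib)
  \<comment> \<open>At a light symbol both probabilities are at most 1/4, so the denominator in
    \<open>w\<close> is at least 1/2.\<close>
  have wle: "w a \<le> 2 * (q a * q' a)" if "a \<in> C" for a
  proof (cases "light a")
    case True
    then have "1/2 \<le> 1 - q a - q' a" using \<eta> unfolding light_def by auto
    moreover have "0 \<le> q a * q' a" using q(1) q'(1) that by auto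
    ultimately have "q a * q' a / (1 - q a - q' a) \<le> q a * q' a / (1/2)"
      by (intro divide_left_mono) auto
    then show ?thesis using True unfolding w_def by auto
  qed (use q(1) q'(1) that in \<open>auto simp: w_def\<close>)
  have cle: "c a \<le> 2 * (q a * q' a)" if "a \<in> C" for a
  proof -
    have "c a \<le> w a" unfolding c_def using S0 w0[OF that] by (simp add: divide_le_eq mult_right_mono algebra_simps)
    with wle[OF that] show ?thesis by linarith
  qed
  have diag: "J a a = (if light a then 0 else q a * q' a * (1 - K))" if "a \<in> C" for a
  proof (cases "light a")
    case True
    then have ne: "1 - q a - q' a \<noteq> 0" using \<eta> unfolding light_def by auto
    have "J a a = q a * q' a * (1 - K) - c a * (1 - q a - q' a)"
      unfolding J_def by (simp add: algebra_simps)
    also have "c a * (1 - q a - q' a) = q a * q' a * (1 - K)"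
      using True ne K(2) S0 unfolding c_def w_def by simp
    finally show ?thesis using True by simp
  next
    case False
    then show ?thesis unfolding J_def c_def w_def by simp
  qed
  show ?thesis
  proof (rule that[of J])
    fix a b assume ab: "a \<in> C" "b \<in> C"
    show "0 \<le> J a b"
    proof (cases "a = b")
      case True
      then show ?thesis using diag ab q q' K1 by simp
    next
      case False
      then show ?thesis unfolding J_def using ab q q' K1 c0 by simp
    qed
  next
    fix a assume a: "a \<in> C"
    have "(\<Sum>b\<in>C. J a b) = q a * sum q' C * (1 - K) + c a * sum q' C + q a * sum c C - c a"
      unfolding J_def using a fin by (simp add: sum.distrib sum_subtractf sum_distrib_left sum_distrib_right)
    then show "(\<Sum>b\<in>C. J a b) = q a" using q' sumc by (simp add: algebra_simps)
  next
    fix b assume b: "b \<in> C"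
    have "(\<Sum>a\<in>C. J a b) = sum q C * q' b * (1 - K) + sum c C * q' b + sum q C * c b - c b"
      unfolding J_def using b fin by (simp add: sum.distrib sum_subtractf sum_distrib_left sum_distrib_right)
    then show "(\<Sum>a\<in>C. J a b) = q' b" using q sumc by (simp add: algebra_simps)
  next
    fix a assume a: "a \<in> C"
    have "0 \<le> q a * q' a" using a q q' by simp
    moreover from this have "q a * q' a * (1 - K) \<le> q a * q' a" using K1 by (simp add: mult_left_le)
    ultimately show "J a a \<le> q a * q' a * (of_bool (\<eta> < q a) + of_bool (\<eta> < q' a))"
      using diag[OF a] unfolding light_def by (auto simp: of_bool_def)
  next
    fix F G :: "'a \<Rightarrow> real"
    define f where "f = (\<Sum>a\<in>C. q a * F a)"
    define g where "g = (\<Sum>b\<in>C. q' b * G b)"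
    have "(\<Sum>a\<in>C. \<Sum>b\<in>C. J a b * (F a * G b)) =
      (\<Sum>a\<in>C. \<Sum>b\<in>C. (q a * F a) * (q' b * G b) * (1 - K) + (c a * F a) * (q' b * G b)
         + (q a * F a) * (c b * G b) - (if a = b then c a * F a * G a else 0))"
      unfolding J_def by (intro sum.cong refl) (auto simp: algebra_simps)
    also have "\<dots> = f * g * (1 - K) + (\<Sum>a\<in>C. c a * F a) * g + f * (\<Sum>b\<in>C. c b * G b)
         - (\<Sum>a\<in>C. c a * F a * G a)"
    proof -
      have prod: "(\<Sum>a\<in>C. \<Sum>b\<in>C. u a * v b) = sum u C * sum v C" for u v :: "'a \<Rightarrow> real"
        by (simp add: sum_product)
      have prod': "(\<Sum>a\<in>C. \<Sum>b\<in>C. u a * v b * z) = sum u C * sum v C * z" for u v :: "'a \<Rightarrow> real" and z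
        by (simp add: prod flip: sum_distrib_right)
      show ?thesis
        using fin unfolding f_def g_def by (simp add: sum.distrib sum_subtractf prod prod')
    qed
    \<comment> \<open>The correction is a \<open>c\<close>-weighted sum of products of centred
      values, so the error depends on \<open>F\<close> and \<open>G\<close> only through their
      deviations from the means.\<close>
    also have "\<dots> = f * g - (\<Sum>a\<in>C. c a * ((F a - f) * (G a - g)))"
    proof -
      have "(\<Sum>a\<in>C. c a * ((F a - f) * (G a - g))) =
        (\<Sum>a\<in>C. c a * F a * G a - (c a * F a) * g - f * (c a * G a) + c a * (f * g))"
        by (intro sum.cong) (auto simp: algebra_simps)
      also have "\<dots> = (\<Sum>a\<in>C. c a * F a * G a) - (\<Sum>a\<in>C. c a * F a) * g
         - f * (\<Sum>a\<in>C. c a * G a) + K * (f * g)"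
        by (simp add: sum.distrib sum_subtractf sumc[symmetric] sum_distrib_left sum_distrib_right)
      finally show ?thesis by (simp add: algebra_simps)
    qed
    also have "\<dots> \<le> f * g + \<eta> * ((\<Sum>a\<in>C. q a * (F a - f)\<^sup>2) + (\<Sum>a\<in>C. q' a * (G a - g)\<^sup>2))"
    proof -
      \<comment> \<open>For light \<open>a\<close>, the product is split by the arithmetic-geometric
        mean inequality; in \<open>q a * q' a\<close> the factor \<open>q' a\<close> is then bounded
        by \<eta> in the \<open>F\<close> part and \<open>q a\<close> in the \<open>G\<close> part.
        At other symbols \<open>c a\<close> is 0.\<close>
      have "- (c a * ((F a - f) * (G a - g))) \<le> \<eta> * (q a * (F a - f)\<^sup>2 + q' a * (G a - g)\<^sup>2)"
        if a: "a \<in> C" for a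
      proof (cases "light a")
        case True
        let ?u = "F a - f" and ?v = "G a - g"
        have "- (c a * (?u * ?v)) \<le> c a * ((?u\<^sup>2 + ?v\<^sup>2) / 2)"
        proof -
          have "0 \<le> (?u + ?v)\<^sup>2" by simp
          then have "- (?u * ?v) \<le> (?u\<^sup>2 + ?v\<^sup>2) / 2" by (simp add: power2_eq_square algebra_simps)
          from mult_left_mono[OF this c0[OF a]] show ?thesis by simp
        qed
        also have "\<dots> \<le> 2 * (q a * q' a) * ((?u\<^sup>2 + ?v\<^sup>2) / 2)"
          using cle[OF a] by (intro mult_right_mono) auto
        also have "\<dots> = q' a * (q a * ?u\<^sup>2) + q a * (q' a * ?v\<^sup>2)" by (simp add: algebra_simps)
        also have "\<dots> \<le> \<eta> * (q a * ?u\<^sup>2) + \<eta> * (q' a * ?v\<^sup>2)"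
          using True q(1)[OF a] q'(1)[OF a] unfolding light_def by (intro add_mono mult_right_mono) auto
        finally show ?thesis by (simp add: algebra_simps)
      next
        case False
        then show ?thesis using q(1)[OF a] q'(1)[OF a] \<eta> unfolding c_def w_def by simp
      qed
      then have "(\<Sum>a\<in>C. - (c a * ((F a - f) * (G a - g)))) \<le> (\<Sum>a\<in>C. \<eta> * (q a * (F a - f)\<^sup>2 + q' a * (G a - g)\<^sup>2))"
        by (rule sum_mono)
      then show ?thesis by (simp add: sum_negf sum.distrib flip: sum_distrib_left)
    qed
    finally show "(\<Sum>a\<in>C. \<Sum>b\<in>C. J a b * (F a * G b)) \<le> (\<Sum>a\<in>C. q a * F a) * (\<Sum>b\<in>C. q' b * G b)
       + \<eta> * ((\<Sum>a\<in>C. q a * (F a)\<^sup>2) - (\<Sum>a\<in>C. q a * F a)\<^sup>2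
            + ((\<Sum>b\<in>C. q' b * (G b)\<^sup>2) - (\<Sum>b\<in>C. q' b * G b)\<^sup>2))"
      unfolding sum_weighted_square_shift[OF q(2)] sum_weighted_square_shift[OF q'(2)] f_def g_def by simp
  qed
qed

section \<open>Marginals and relative entropy of a family\<close>

definition marg :: "(nat \<Rightarrow> nat) set \<Rightarrow> nat set \<Rightarrow> (nat \<Rightarrow> nat) \<Rightarrow> real" where
  "marg B S x = real (card {y \<in> B. restrict y S = x}) / real (card B)"

definition freq :: "(nat \<Rightarrow> nat) set \<Rightarrow> nat \<Rightarrow> nat \<Rightarrow> real" where
  "freq B i a = real (card {y \<in> B. y i = a}) / real (card B)"

text \<open>Relative to the uniform measure on the cube; the junk value of \<open>ln 0\<close> is harmless.\<close>

definition rel_ent :: "nat \<Rightarrow> (nat \<Rightarrow> nat) set \<Rightarrow> nat set \<Rightarrow> real" where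
  "rel_ent m B S = (\<Sum>x\<in>cube m S. marg B S x * ln (marg B S x * real m ^ card S))"

text \<open>On prefixes of probability zero any probability vector would do.\<close>

definition cond_marg :: "nat \<Rightarrow> (nat \<Rightarrow> nat) set \<Rightarrow> nat set \<Rightarrow> nat \<Rightarrow> (nat \<Rightarrow> nat) \<Rightarrow> nat \<Rightarrow> real" where
  "cond_marg m B S i x a = (if marg B S x = 0 then 1 / real m else marg B (insert i S) (x(i := a)) / marg B S x)"

lemma marg_nonneg [simp]: "0 \<le> marg B S x" unfolding marg_def by simp

lemma card_fibres:
  assumes "finite B" "finite X" "\<And>y. y \<in> B \<Longrightarrow> Q y \<Longrightarrow> g y \<in> X"
  shows "card {y \<in> B. Q y} = (\<Sum>x\<in>X. card {y \<in> B. g y = x \<and> Q y})"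
proof -
  have "g ` {y \<in> B. Q y} \<subseteq> X" using assms(3) by blast
  then have "card {y \<in> B. Q y} = (\<Sum>x\<in>X. card {y \<in> {y \<in> B. Q y}. g y = x})"
    using sum.group[of "{y \<in> B. Q y}" X g "\<lambda>_. 1::nat"] assms(1,2) by simp
  also have "\<dots> = (\<Sum>x\<in>X. card {y \<in> B. g y = x \<and> Q y})"
    by (intro sum.cong refl arg_cong[of _ _ card]) blast
  finally show ?thesis .
qed

lemma marg_insert_eq:
  assumes "x \<in> cube m S" "i \<notin> S"
  shows "marg B (insert i S) (x(i := a)) = real (card {y \<in> B. restrict y S = x \<and> y i = a}) / real (card B)"
  unfolding marg_def restrict_insert_eq_iff[OF assms] ..

lemma marg_insert:
  assumes "finite B" "x \<in> cube m S" "i \<notin> S" "\<forall>y\<in>B. y i \<in> {1..m}"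
  shows "(\<Sum>a=1..m. marg B (insert i S) (x(i := a))) = marg B S x"
proof -
  have "card {y \<in> B. restrict y S = x} = (\<Sum>a=1..m. card {y \<in> B. y i = a \<and> restrict y S = x})"
    using assms(1,4) by (intro card_fibres) auto
  then have "marg B S x = (\<Sum>a=1..m. real (card {y \<in> B. y i = a \<and> restrict y S = x}) / real (card B))"
    unfolding marg_def sum_divide_distrib[symmetric] by (simp only: of_nat_sum)
  then show ?thesis unfolding marg_insert_eq[OF assms(2,3)] by (simp only: conj_commute)
qed

lemma marg_empty: "finite B \<Longrightarrow> B \<noteq> {} \<Longrightarrow> marg B {} (\<lambda>_. undefined) = 1"
  unfolding marg_def by (simp add: restrict_def)

text \<open>\<open>Q\<close> is a general event about the past: it is \<open>True\<close> for the
  law of coordinate \<open>i\<close> alone, and \<open>x l = b\<close> for its joint law with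
  another coordinate \<open>l\<close>.\<close>

lemma sum_marg_insert:
  assumes "finite S" "finite B" "i \<notin> S" "\<forall>y\<in>B. \<forall>j\<in>S. y j \<in> {1..m}"
  shows "(\<Sum>x\<in>{x \<in> cube m S. Q x}. marg B (insert i S) (x(i := a)))
    = real (card {y \<in> B. y i = a \<and> Q (restrict y S)}) / real (card B)"
proof -
  have "card {y \<in> B. y i = a \<and> Q (restrict y S)} = (\<Sum>x\<in>{x \<in> cube m S. Q x}. card {y \<in> B. restrict y S = x \<and> (y i = a \<and> Q (restrict y S))})"
    using assms(2,4) by (intro card_fibres) (auto simp: assms(1), auto simp: cube_def)
  also have "\<dots> = (\<Sum>x\<in>{x \<in> cube m S. Q x}. card {y \<in> B. restrict y S = x \<and> y i = a})"
    by (intro sum.cong refl arg_cong[of _ _ card]) blast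
  finally have "real (card {y \<in> B. y i = a \<and> Q (restrict y S)}) = (\<Sum>x\<in>{x \<in> cube m S. Q x}. real (card {y \<in> B. restrict y S = x \<and> y i = a}))"
    by (simp only: of_nat_sum)
  moreover have "(\<Sum>x\<in>{x \<in> cube m S. Q x}. marg B (insert i S) (x(i := a)))
    = (\<Sum>x\<in>{x \<in> cube m S. Q x}. real (card {y \<in> B. restrict y S = x \<and> y i = a}) / real (card B))"
    by (intro sum.cong refl marg_insert_eq) (use assms(3) in blast)+
  ultimately show ?thesis by (simp only: sum_divide_distrib)
qed

lemma sum_marg_filter:
  assumes "finite S" "finite B" "\<forall>y\<in>B. \<forall>j\<in>S. y j \<in> {1..m}"
  shows "(\<Sum>x\<in>{x \<in> cube m S. Q x}. marg B S x)
    = real (card {y \<in> B. Q (restrict y S)}) / real (card B)"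
proof -
  have "card {y \<in> B. Q (restrict y S)} = (\<Sum>x\<in>{x \<in> cube m S. Q x}. card {y \<in> B. restrict y S = x \<and> Q (restrict y S)})"
    using assms(2,3) by (intro card_fibres) (auto simp: assms(1), auto simp: cube_def)
  also have "\<dots> = (\<Sum>x\<in>{x \<in> cube m S. Q x}. card {y \<in> B. restrict y S = x})"
    by (intro sum.cong refl arg_cong[of _ _ card]) blast
  finally have "real (card {y \<in> B. Q (restrict y S)}) = (\<Sum>x\<in>{x \<in> cube m S. Q x}. real (card {y \<in> B. restrict y S = x}))"
    by (simp only: of_nat_sum)
  then show ?thesis unfolding marg_def by (simp only: sum_divide_distrib)
qed

lemma sum_marg:
  assumes "finite S" "finite B" "B \<noteq> {}" "\<forall>y\<in>B. \<forall>j\<in>S. y j \<in> {1..m}"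
  shows "(\<Sum>x\<in>cube m S. marg B S x) = 1"
  using sum_marg_filter[OF assms(1,2,4), where Q = "\<lambda>_. True"] assms(2,3) by simp

lemma sum_marg_coordinate:
  assumes "finite S" "finite B" "i \<notin> S" "\<forall>y\<in>B. \<forall>j\<in>S. y j \<in> {1..m}"
  shows "(\<Sum>x\<in>cube m S. marg B (insert i S) (x(i := a))) = freq B i a"
  using sum_marg_insert[OF assms, where Q = "\<lambda>_. True"] unfolding freq_def by simp

text \<open>The product formula survives prefixes of probability zero: the probabilities of their
  extensions add up to zero, hence all vanish.\<close>

lemma cond_marg_properties:
  assumes "finite B" "x \<in> cube m S" "i \<notin> S" "\<forall>y\<in>B. y i \<in> {1..m}" "0 < m"
  shows "0 \<le> cond_marg m B S i x a"
    and "(\<Sum>a=1..m. cond_marg m B S i x a) = 1"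
    and "a \<in> {1..m} \<Longrightarrow> marg B S x * cond_marg m B S i x a = marg B (insert i S) (x(i := a))"
proof -
  have s: "(\<Sum>a=1..m. marg B (insert i S) (x(i := a))) = marg B S x"
    by (rule marg_insert) (use assms in auto)
  show "0 \<le> cond_marg m B S i x a" unfolding cond_marg_def by simp
  show "(\<Sum>a=1..m. cond_marg m B S i x a) = 1"
    using s assms(5) unfolding cond_marg_def by (cases "marg B S x = 0") (simp_all flip: sum_divide_distrib)
  show "marg B S x * cond_marg m B S i x a = marg B (insert i S) (x(i := a))" if "a \<in> {1..m}"
  proof (cases "marg B S x = 0")
    case True
    then have "\<forall>a\<in>{1..m}. marg B (insert i S) (x(i := a)) = 0"
      using s by (simp add: sum_nonneg_eq_0_iff)
    then show ?thesis using True that by simp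
  qed (simp add: cond_marg_def)
qed

section \<open>Relative entropy against distances from the uniform law\<close>

text \<open>This is \<open>ln z \<le> z - 1\<close> at \<open>z = 1 / sqrt u\<close>, multiplied by
  \<open>2 * u\<close>. The left side is a squared Hellinger term, from which quadratic and absolute
  deviations are both derived.\<close>

lemma kl_ge_hellinger:
  assumes "0 \<le> (u::real)"
  shows "(sqrt u - 1)\<^sup>2 \<le> u * ln u - u + 1"
proof (cases "u = 0")
  case False
  then have u: "0 < u" using assms by simp
  have "ln (1 / sqrt u) \<le> 1 / sqrt u - 1" using u by (intro ln_le_minus_one) auto
  moreover have "ln (1 / sqrt u) = - ln u / 2" using u by (simp add: ln_div ln_sqrt)
  ultimately have "2 - 2 / sqrt u \<le> ln u" by simp
  from mult_left_mono[OF this, of u] u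
  have "2 * u - 2 * (u / sqrt u) \<le> u * ln u" by (simp add: algebra_simps)
  moreover have "u / sqrt u = sqrt u" using u by (simp add: real_div_sqrt)
  ultimately show ?thesis using u by (simp add: power2_diff)
qed simp

text \<open>Factor \<open>u - 1\<close> as \<open>(sqrt u - 1) * (sqrt u + 1)\<close>; the square of
  the second factor is at most \<open>4 * m\<close>.\<close>

lemma kl_ge_square:
  assumes "0 \<le> (u::real)" "u \<le> m" "1 \<le> m"
  shows "(u - 1)\<^sup>2 \<le> 4 * m * (u * ln u - u + 1)"
proof -
  have "(u - 1)\<^sup>2 = (sqrt u - 1)\<^sup>2 * (sqrt u + 1)\<^sup>2"
    using assms by (simp flip: power_mult_distrib add: algebra_simps)
  also have "\<dots> \<le> (u * ln u - u + 1) * (4 * m)"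
  proof (intro mult_mono kl_ge_hellinger)
    have "sqrt u \<le> sqrt m" "1 \<le> sqrt m" using assms by auto
    then have "sqrt u + 1 \<le> 2 * sqrt m" by linarith
    then have "(sqrt u + 1)\<^sup>2 \<le> (2 * sqrt m)\<^sup>2"
      using assms by (intro power_mono) auto
    then show "(sqrt u + 1)\<^sup>2 \<le> 4 * m" using assms by (simp add: power_mult_distrib)
    show "0 \<le> u * ln u - u + 1" using kl_ge_hellinger[OF assms(1)] by (meson order.trans zero_le_power2)
  qed (use assms in auto)
  finally show ?thesis by (simp add: mult.commute)
qed

text \<open>The same factorisation, with the product split by Young's inequality. The free parameter
  \<open>t\<close> keeps the bound linear in the entropy term, so that it can be summed over
  coordinates.\<close>

lemma kl_ge_abs:
  assumes "0 \<le> (u::real)" "0 < t"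
  shows "\<bar>u - 1\<bar> \<le> (u * ln u - u + 1) / (4 * t) + 2 * t * (u + 1)"
proof -
  define x where "x = \<bar>sqrt u - 1\<bar>"
  define y where "y = sqrt u + 1"
  have "\<bar>u - 1\<bar> = \<bar>(sqrt u - 1) * (sqrt u + 1)\<bar>" using assms by (simp add: algebra_simps)
  also have "\<dots> = x * y" using assms unfolding x_def y_def by (simp add: abs_mult)
  also have "\<dots> \<le> x\<^sup>2 / (4 * t) + t * y\<^sup>2"
  proof -
    have "0 \<le> (x - 2 * t * y)\<^sup>2 / (4 * t)" using assms by simp
    also have "\<dots> = x\<^sup>2 / (4 * t) + t * y\<^sup>2 - x * y"
      using assms by (simp add: field_simps power2_eq_square)
    finally show ?thesis by simp
  qed
  also have "\<dots> \<le> (u * ln u - u + 1) / (4 * t) + t * (2 * (u + 1))"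
  proof (intro add_mono divide_right_mono mult_left_mono)
    show "x\<^sup>2 \<le> u * ln u - u + 1" using kl_ge_hellinger[OF assms(1)] unfolding x_def by simp
    have "0 \<le> (sqrt u - 1)\<^sup>2" by simp
    then show "y\<^sup>2 \<le> 2 * (u + 1)" using assms unfolding y_def by (simp add: power2_eq_square algebra_simps)
  qed (use assms in auto)
  finally show ?thesis by (simp add: algebra_simps)
qed

text \<open>The pointwise bounds carry the correction \<open>- u + 1\<close> with
  \<open>u = m * q a\<close>; over a probability vector it sums to zero and only the relative
  entropy is left.\<close>

lemma sum_kl:
  fixes q :: "nat \<Rightarrow> real"
  assumes "0 < m" "(\<Sum>a=1..m. q a) = 1"
  shows "(\<Sum>a=1..m. m * q a * ln (m * q a) - m * q a + (1::real)) = m * (\<Sum>a=1..m. q a * ln (m * q a))"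
  using assms by (simp add: sum.distrib sum_subtractf sum_distrib_left[symmetric] mult.assoc)

text \<open>Rescale to \<open>u = m * q a\<close>, which is at most \<open>m\<close>. One factor
  \<open>m\<close> from \<open>kl_ge_square\<close> and one from \<open>sum_kl\<close> cancel the
  \<open>m\<^sup>2\<close> of the rescaling.\<close>

lemma sum_square_le_kl:
  fixes q :: "nat \<Rightarrow> real"
  assumes "0 < m" "\<And>a. a \<in> {1..m} \<Longrightarrow> 0 \<le> q a" "(\<Sum>a=1..m. q a) = 1"
  shows "(\<Sum>a=1..m. (q a - 1 / m)\<^sup>2) \<le> 4 * (\<Sum>a=1..m. q a * ln (m * q a))"
proof -
  have "(real m)\<^sup>2 * (\<Sum>a=1..m. (q a - 1 / m)\<^sup>2) = (\<Sum>a=1..m. (m * q a - 1)\<^sup>2)"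
  proof -
    have "(real m)\<^sup>2 * (q a - 1 / m)\<^sup>2 = (m * q a - 1)\<^sup>2" for a
      using assms(1) by (simp add: right_diff_distrib flip: power_mult_distrib)
    then show ?thesis by (simp add: sum_distrib_left)
  qed
  also have "\<dots> \<le> (\<Sum>a=1..m. 4 * real m * ((m * q a) * ln (m * q a) - m * q a + 1))"
  proof (intro sum_mono kl_ge_square)
    fix a assume a: "a \<in> {1..m}"
    have "q a \<le> (\<Sum>a=1..m. q a)" using a assms(2) by (intro member_le_sum) auto
    then show "m * q a \<le> m" using assms by simp
  qed (use assms in auto)
  also have "\<dots> = 4 * real m * (m * (\<Sum>a=1..m. q a * ln (m * q a)))"
    unfolding sum_kl[OF assms(1,3), symmetric] by (simp add: sum_distrib_left)
  finally have "(real m)\<^sup>2 * (\<Sum>a=1..m. (q a - 1 / m)\<^sup>2) \<le> (real m)\<^sup>2 * (4 * (\<Sum>a=1..m. q a * ln (m * q a)))"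
    by (simp add: power2_eq_square algebra_simps)
  then show ?thesis using assms(1) by simp
qed

text \<open>An additive form of Pinsker's inequality; optimising \<open>t\<close> would give the
  square-root form up to a constant.\<close>

lemma sum_abs_le_kl:
  fixes q :: "nat \<Rightarrow> real"
  assumes "0 < m" "\<And>a. a \<in> {1..m} \<Longrightarrow> 0 \<le> q a" "(\<Sum>a=1..m. q a) = 1" "0 < t"
  shows "(\<Sum>a=1..m. \<bar>q a - 1 / m\<bar>) \<le> (\<Sum>a=1..m. q a * ln (m * q a)) / (4 * t) + 4 * t"
proof -
  have "m * (\<Sum>a=1..m. \<bar>q a - 1 / m\<bar>) = (\<Sum>a=1..m. \<bar>m * q a - 1\<bar>)"
  proof -
    have "m * \<bar>q a - 1 / m\<bar> = \<bar>m * q a - 1\<bar>" for a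
      using assms(1) by (simp add: abs_mult_pos' algebra_simps)
    then show ?thesis by (simp add: sum_distrib_left)
  qed
  also have "\<dots> \<le> (\<Sum>a=1..m. ((m * q a) * ln (m * q a) - m * q a + 1) / (4 * t) + 2 * t * (m * q a + 1))"
    using assms by (intro sum_mono kl_ge_abs) auto
  also have "\<dots> = (\<Sum>a=1..m. m * q a * ln (m * q a) - m * q a + (1::real)) / (4 * t)
      + 2 * t * (\<Sum>a=1..m. m * q a + 1)"
    unfolding sum.distrib[of "\<lambda>a. (m * q a * ln (m * q a) - m * q a + 1) / (4 * t)"] sum_divide_distrib sum_distrib_left by simp
  also have "(\<Sum>a=1..m. m * q a + 1) = 2 * real m"
    using assms(3) by (simp add: sum.distrib flip: sum_distrib_left)
  also have "(\<Sum>a=1..m. m * q a * ln (m * q a) - m * q a + (1::real)) / (4 * t) + 2 * t * (2 * real m)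
      = m * ((\<Sum>a=1..m. q a * ln (m * q a)) / (4 * t) + 4 * t)"
    unfolding sum_kl[OF assms(1,3)] by (simp add: algebra_simps)
  finally show ?thesis using assms(1) by simp
qed

section \<open>The chain rule for relative entropy\<close>

text \<open>The logarithm of the density of the extended prefix splits into that of the prefix and
  that of the conditional law; the first part is summed against conditional probabilities of total
  1.\<close>

lemma rel_ent_insert:
  assumes "finite S" "finite B" "i \<notin> S" "\<forall>y\<in>B. y i \<in> {1..m}" "0 < m"
  shows "rel_ent m B (insert i S) - rel_ent m B S =
    (\<Sum>x\<in>cube m S. marg B S x * (\<Sum>a=1..m. cond_marg m B S i x a * ln (m * cond_marg m B S i x a)))"
proof -
  have "(\<Sum>a=1..m. marg B (insert i S) (x(i := a)) * ln (marg B (insert i S) (x(i := a)) * real m ^ card (insert i S)))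
     = marg B S x * ln (marg B S x * real m ^ card S)
       + marg B S x * (\<Sum>a=1..m. cond_marg m B S i x a * ln (m * cond_marg m B S i x a))"
    if x: "x \<in> cube m S" for x
  proof -
    note c = cond_marg_properties[OF assms(2) x assms(3-5)]
    let ?p = "marg B S x" and ?q = "cond_marg m B S i x"
    have "marg B (insert i S) (x(i := a)) * ln (marg B (insert i S) (x(i := a)) * real m ^ card (insert i S))
        = ?p * ?q a * ln (?p * real m ^ card S) + ?p * (?q a * ln (m * ?q a))" if a: "a \<in> {1..m}" for a
    \<comment> \<open>If a factor vanishes, both sides are 0 whatever \<open>ln 0\<close> is;
      otherwise the logarithm of the product may be split.\<close>
    proof (cases "?p = 0 \<or> ?q a = 0")
      case True
      then show ?thesis using c(3)[OF a] by auto
    next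
      case False
      then have pos: "0 < ?p" "0 < ?q a" using c(1)[of a] by (auto simp: less_le)
      have "?p * ?q a * real m ^ card (insert i S) = (?p * real m ^ card S) * (m * ?q a)"
        using assms by simp
      then have "ln (?p * ?q a * real m ^ card (insert i S)) = ln (?p * real m ^ card S) + ln (m * ?q a)"
        using pos assms(5) by (simp add: ln_mult)
      then show ?thesis unfolding c(3)[OF a, symmetric] by (simp add: algebra_simps)
    qed
    then have "(\<Sum>a=1..m. marg B (insert i S) (x(i := a)) * ln (marg B (insert i S) (x(i := a)) * real m ^ card (insert i S)))
      = (\<Sum>a=1..m. ?q a * (?p * ln (?p * real m ^ card S)) + ?p * (?q a * ln (m * ?q a)))"
      by (intro sum.cong) (auto simp: algebra_simps)
    also have "\<dots> = ?p * ln (?p * real m ^ card S) + ?p * (\<Sum>a=1..m. ?q a * ln (m * ?q a))"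
      unfolding sum.distrib sum_distrib_right[symmetric] sum_distrib_left[symmetric] c(2) by simp
    finally show ?thesis .
  qed
  then show ?thesis unfolding rel_ent_def sum_cube_insert[OF assms(3)] by (simp add: sum.distrib)
qed

lemma rel_ent_empty: "finite B \<Longrightarrow> B \<noteq> {} \<Longrightarrow> rel_ent m B {} = 0"
  unfolding rel_ent_def by (simp add: marg_empty)

text \<open>Apply \<open>sum_square_le_kl\<close> to the conditional law on every prefix and
  average; the chain rule identifies the right side as an entropy increment.\<close>

lemma variance_le_rel_ent:
  assumes "finite S" "finite B" "i \<notin> S" "\<forall>y\<in>B. y i \<in> {1..m}" "0 < m"
  shows "(\<Sum>a=1..m. \<Sum>x\<in>cube m S. marg B S x * (cond_marg m B S i x a - 1 / m)\<^sup>2)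
    \<le> 4 * (rel_ent m B (insert i S) - rel_ent m B S)"
proof -
  have "(\<Sum>a=1..m. \<Sum>x\<in>cube m S. marg B S x * (cond_marg m B S i x a - 1 / m)\<^sup>2)
     = (\<Sum>x\<in>cube m S. marg B S x * (\<Sum>a=1..m. (cond_marg m B S i x a - 1 / m)\<^sup>2))"
    by (subst sum.swap) (simp add: sum_distrib_left)
  also have "\<dots> \<le> (\<Sum>x\<in>cube m S. marg B S x * (4 * (\<Sum>a=1..m. cond_marg m B S i x a * ln (m * cond_marg m B S i x a))))"
    using cond_marg_properties[OF assms(2) _ assms(3-5)] assms(5)
    by (intro sum_mono mult_left_mono sum_square_le_kl) auto
  also have "\<dots> = 4 * (rel_ent m B (insert i S) - rel_ent m B S)"
    unfolding rel_ent_insert[OF assms] by (simp add: sum_distrib_left algebra_simps)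
  finally show ?thesis .
qed

lemma deviation_le_rel_ent:
  assumes "finite S" "finite B" "B \<noteq> {}" "i \<notin> S" "\<forall>y\<in>B. \<forall>j\<in>insert i S. y j \<in> {1..m}" "0 < m" "0 < t"
  shows "(\<Sum>a=1..m. \<Sum>x\<in>cube m S. \<bar>marg B (insert i S) (x(i := a)) - marg B S x / m\<bar>)
    \<le> (rel_ent m B (insert i S) - rel_ent m B S) / (4 * t) + 4 * t"
proof -
  have i: "\<forall>y\<in>B. y i \<in> {1..m}" using assms(5) by blast
  note c = cond_marg_properties[OF assms(2) _ assms(4) i assms(6)]
  have "(\<Sum>a=1..m. \<Sum>x\<in>cube m S. \<bar>marg B (insert i S) (x(i := a)) - marg B S x / m\<bar>)
     = (\<Sum>x\<in>cube m S. \<Sum>a=1..m. \<bar>marg B (insert i S) (x(i := a)) - marg B S x / m\<bar>)"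
    by (rule sum.swap)
  also have "\<dots> = (\<Sum>x\<in>cube m S. marg B S x * (\<Sum>a=1..m. \<bar>cond_marg m B S i x a - 1 / m\<bar>))"
  proof (intro sum.cong refl)
    fix x assume x: "x \<in> cube m S"
    show "(\<Sum>a=1..m. \<bar>marg B (insert i S) (x(i := a)) - marg B S x / m\<bar>) = marg B S x * (\<Sum>a=1..m. \<bar>cond_marg m B S i x a - 1 / m\<bar>)"
      unfolding sum_distrib_left
    proof (intro sum.cong refl)
      fix a assume "a \<in> {1..m}"
      then have "marg B (insert i S) (x(i := a)) - marg B S x / m = marg B S x * (cond_marg m B S i x a - 1 / m)"
        using c(3)[OF x] by (simp add: algebra_simps)
      then show "\<bar>marg B (insert i S) (x(i := a)) - marg B S x / m\<bar> = marg B S x * \<bar>cond_marg m B S i x a - 1 / m\<bar>"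
        by (simp add: abs_mult)
    qed
  qed
  also have "\<dots> \<le> (\<Sum>x\<in>cube m S. marg B S x * ((\<Sum>a=1..m. cond_marg m B S i x a * ln (m * cond_marg m B S i x a)) / (4 * t) + 4 * t))"
    using c assms(6,7) by (intro sum_mono mult_left_mono sum_abs_le_kl) auto
  also have "\<dots> = (rel_ent m B (insert i S) - rel_ent m B S) / (4 * t) + 4 * t * (\<Sum>x\<in>cube m S. marg B S x)"
    unfolding rel_ent_insert[OF assms(1,2,4) i assms(6), simplified]
    by (simp add: sum_divide_distrib sum_distrib_left sum.distrib distrib_left mult.commute)
  also have "(\<Sum>x\<in>cube m S. marg B S x) = 1" using assms by (intro sum_marg) auto
  finally show ?thesis by (simp only: mult_1_right)
qed

section \<open>Coupling two families with few agreements\<close>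

definition mean :: "nat \<Rightarrow> (nat \<Rightarrow> nat) set \<Rightarrow> nat set \<Rightarrow> ((nat \<Rightarrow> nat) \<Rightarrow> real) \<Rightarrow> real" where
  "mean m B S F = (\<Sum>x\<in>cube m S. marg B S x * F x)"

definition var :: "nat \<Rightarrow> (nat \<Rightarrow> nat) set \<Rightarrow> nat set \<Rightarrow> ((nat \<Rightarrow> nat) \<Rightarrow> real) \<Rightarrow> real" where
  "var m B S F = mean m B S (\<lambda>x. (F x)\<^sup>2) - (mean m B S F)\<^sup>2"

lemma mean_mono: "(\<And>x. x \<in> cube m S \<Longrightarrow> F x \<le> G x) \<Longrightarrow> mean m B S F \<le> mean m B S G"
  unfolding mean_def by (intro sum_mono mult_left_mono) auto

lemma mean_nonneg: "(\<And>x. x \<in> cube m S \<Longrightarrow> 0 \<le> F x) \<Longrightarrow> 0 \<le> mean m B S F"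
  unfolding mean_def by (intro sum_nonneg mult_nonneg_nonneg) auto

lemma mean_cmult: "mean m B S (\<lambda>x. c * F x) = c * mean m B S F"
  unfolding mean_def by (simp add: sum_distrib_left mult.left_commute)

lemma mean_diff: "mean m B S (\<lambda>x. F x - G x) = mean m B S F - mean m B S G"
  unfolding mean_def by (simp add: algebra_simps sum_subtractf)

lemma mean_insert:
  assumes "finite B" "i \<notin> S" "\<forall>y\<in>B. y i \<in> {1..m}" "0 < m"
  shows "mean m B (insert i S) F = mean m B S (\<lambda>x. \<Sum>a=1..m. cond_marg m B S i x a * F (x(i := a)))"
proof -
  have "(\<Sum>a=1..m. marg B (insert i S) (x(i := a)) * F (x(i := a)))
      = marg B S x * (\<Sum>a=1..m. cond_marg m B S i x a * F (x(i := a)))" if x: "x \<in> cube m S" for x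
    unfolding sum_distrib_left
  proof (rule sum.cong[OF refl])
    fix a assume "a \<in> {1..m}"
    from cond_marg_properties(3)[OF assms(1) x assms(2-4) this]
    show "marg B (insert i S) (x(i := a)) * F (x(i := a)) = marg B S x * (cond_marg m B S i x a * F (x(i := a)))"
      by (simp only: mult.assoc[symmetric])
  qed
  then show ?thesis unfolding mean_def sum_cube_insert[OF assms(2)] by (intro sum.cong) auto
qed

lemma mean_cond_marg:
  assumes "finite S" "finite B" "i \<notin> S" "\<forall>y\<in>B. \<forall>j\<in>insert i S. y j \<in> {1..m}" "0 < m" "a \<in> {1..m}"
  shows "mean m B S (\<lambda>x. cond_marg m B S i x a) = freq B i a"
proof -
  have "mean m B S (\<lambda>x. cond_marg m B S i x a) = (\<Sum>x\<in>cube m S. marg B (insert i S) (x(i := a)))"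
    unfolding mean_def using assms by (intro sum.cong refl cond_marg_properties(3)) auto
  also have "\<dots> = freq B i a" using assms by (intro sum_marg_coordinate) auto
  finally show ?thesis .
qed

lemma var_le_mean_square:
  assumes "finite S" "finite B" "B \<noteq> {}" "\<forall>y\<in>B. \<forall>j\<in>S. y j \<in> {1..m}"
  shows "var m B S F \<le> mean m B S (\<lambda>x. (F x - c)\<^sup>2)"
  unfolding var_def mean_def sum_weighted_square_shift[OF sum_marg[OF assms]] by simp

text \<open>The last conjunct bounds the maximal correlation by \<open>2 * \<eta>\<close>. In this form, with the geometric
  mean of the variances replaced by the arithmetic one, it passes through a coordinatewise
  construction by the law of total variance.\<close>

definition coupling :: "nat \<Rightarrow> real \<Rightarrow> (nat \<Rightarrow> nat) set \<Rightarrow> (nat \<Rightarrow> nat) set \<Rightarrow> nat set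
    \<Rightarrow> ((nat \<Rightarrow> nat) \<Rightarrow> (nat \<Rightarrow> nat) \<Rightarrow> real) \<Rightarrow> bool" where
  "coupling m \<eta> B1 B2 S W \<longleftrightarrow>
     (\<forall>x\<in>cube m S. \<forall>y\<in>cube m S. 0 \<le> W x y) \<and>
     (\<forall>x\<in>cube m S. (\<Sum>y\<in>cube m S. W x y) = marg B1 S x) \<and>
     (\<forall>y\<in>cube m S. (\<Sum>x\<in>cube m S. W x y) = marg B2 S y) \<and>
     (\<forall>F G. (\<Sum>x\<in>cube m S. \<Sum>y\<in>cube m S. W x y * (F x * G y))
        \<le> mean m B1 S F * mean m B2 S G + \<eta> * (var m B1 S F + var m B2 S G))"

section \<open>Building the coupling coordinate by coordinate\<close>

text \<open>Draw the two pasts from \<open>W\<close>, then the next symbols from the off-diagonal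
  coupling of the two conditional laws. A new agreement can come only from a diagonal entry of the
  latter, and these are zero at light symbols.\<close>

lemma coupling_step:
  assumes S: "finite S" "i \<notin> S" and m: "0 < m" and \<eta>: "0 < \<eta>" "\<eta> \<le> 1/4"
    and B1: "finite B1" "\<forall>y\<in>B1. y i \<in> {1..m}"
    and B2: "finite B2" "\<forall>y\<in>B2. y i \<in> {1..m}"
    and W: "coupling m \<eta> B1 B2 S W"
  obtains W' where "coupling m \<eta> B1 B2 (insert i S) W'"
    "(\<Sum>x\<in>cube m (insert i S). \<Sum>y\<in>cube m (insert i S). W' x y * of_bool (\<exists>j\<in>insert i S. x j = y j))
     \<le> (\<Sum>x\<in>cube m S. \<Sum>y\<in>cube m S. W x y * of_bool (\<exists>j\<in>S. x j = y j))
       + (\<Sum>a=1..m. \<Sum>x\<in>cube m S. \<Sum>y\<in>cube m S. W x y * (cond_marg m B1 S i x a * cond_marg m B2 S i y a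
            * (of_bool (\<eta> < cond_marg m B1 S i x a) + of_bool (\<eta> < cond_marg m B2 S i y a))))"
proof -
  define q where "q = cond_marg m B1 S i"
  define q' where "q' = cond_marg m B2 S i"
  note c1 = cond_marg_properties[OF B1(1) _ S(2) B1(2) m, folded q_def]
  note c2 = cond_marg_properties[OF B2(1) _ S(2) B2(2) m, folded q'_def]
  define good where "good x y J \<longleftrightarrow>
    (\<forall>a\<in>{1..m}. \<forall>b\<in>{1..m}. 0 \<le> J a b) \<and>
    (\<forall>a\<in>{1..m}. (\<Sum>b=1..m. J a b) = q x a) \<and>
    (\<forall>b\<in>{1..m}. (\<Sum>a=1..m. J a b) = q' y b) \<and>
    (\<forall>a\<in>{1..m}. J a a \<le> q x a * q' y a * (of_bool (\<eta> < q x a) + of_bool (\<eta> < q' y a))) \<and>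
    (\<forall>F G. (\<Sum>a=1..m. \<Sum>b=1..m. J a b * (F a * G b)) \<le> (\<Sum>a=1..m. q x a * F a) * (\<Sum>b=1..m. q' y b * G b)
       + \<eta> * ((\<Sum>a=1..m. q x a * (F a)\<^sup>2) - (\<Sum>a=1..m. q x a * F a)\<^sup>2
            + ((\<Sum>b=1..m. q' y b * (G b)\<^sup>2) - (\<Sum>b=1..m. q' y b * G b)\<^sup>2)))"
    for x y and J :: "nat \<Rightarrow> nat \<Rightarrow> real"
  have ex: "\<exists>J. good x y J" if xy: "x \<in> cube m S" "y \<in> cube m S" for x y
  proof -
    have q: "\<And>a. a \<in> {1..m} \<Longrightarrow> 0 \<le> q x a" "\<And>a. a \<in> {1..m} \<Longrightarrow> 0 \<le> q' y a"
      using c1(1)[OF xy(1)] c2(1)[OF xy(2)] by blast+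
    show ?thesis
    proof (rule off_diagonal_coupling[OF finite_atLeastAtMost q(1) c1(2)[OF xy(1)] q(2) c2(2)[OF xy(2)] \<eta>], goal_cases)
      case (3 J)
      then have "good x y J" unfolding good_def by blast
      then show ?case by (intro exI[of _ J])
    qed
  qed
  define J where "J x y = (SOME J. good x y J)" for x y
  have J: "good x y (J x y)" if "x \<in> cube m S" "y \<in> cube m S" for x y
    unfolding J_def using ex[OF that] by (rule someI_ex)
  note J1 = J[unfolded good_def, THEN conjunct1, rule_format]
  note J2 = J[unfolded good_def, THEN conjunct2, THEN conjunct1, rule_format]
  note J3 = J[unfolded good_def, THEN conjunct2, THEN conjunct2, THEN conjunct1, rule_format]
  note J4 = J[unfolded good_def, THEN conjunct2, THEN conjunct2, THEN conjunct2, THEN conjunct1, rule_format]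
  note J5 = J[unfolded good_def, THEN conjunct2, THEN conjunct2, THEN conjunct2, THEN conjunct2, rule_format]
  note W1 = W[unfolded coupling_def, THEN conjunct1, rule_format]
  note W2 = W[unfolded coupling_def, THEN conjunct2, THEN conjunct1, rule_format]
  note W3 = W[unfolded coupling_def, THEN conjunct2, THEN conjunct2, THEN conjunct1, rule_format]
  note W4 = W[unfolded coupling_def, THEN conjunct2, THEN conjunct2, THEN conjunct2, rule_format]
  \<comment> \<open>\<open>r\<close> forgets coordinate \<open>i\<close>; the value
    \<open>undefined\<close> there makes the result extensional on \<open>S\<close>.\<close>
  define r where "r x = x(i := undefined)" for x :: "nat \<Rightarrow> nat"
  define W' where "W' x y = W (r x) (r y) * J (r x) (r y) (x i) (y i)" for x y
  have r: "r (x(i := a)) = x" if "x \<in> cube m S" for x a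
    using that S(2) unfolding r_def cube_def by (auto simp: PiE_def extensional_def fun_eq_iff)
  have rc: "r x \<in> cube m S" "x i \<in> {1..m}" "(r x)(i := x i) = x" if "x \<in> cube m (insert i S)" for x
    using that S(2) unfolding r_def cube_def by (auto simp: PiE_def extensional_def Pi_def)
  have W'_upd: "W' (x(i := a)) (y(i := b)) = W x y * J x y a b" if "x \<in> cube m S" "y \<in> cube m S" for x y a b
    unfolding W'_def using r that by simp
  have expand: "(\<Sum>x\<in>cube m (insert i S). \<Sum>y\<in>cube m (insert i S). W' x y * H x y)
     = (\<Sum>x\<in>cube m S. \<Sum>y\<in>cube m S. W x y * (\<Sum>a=1..m. \<Sum>b=1..m. J x y a b * H (x(i := a)) (y(i := b))))" for H
  proof -
    have "(\<Sum>x\<in>cube m (insert i S). \<Sum>y\<in>cube m (insert i S). W' x y * H x y)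
      = (\<Sum>x\<in>cube m S. \<Sum>y\<in>cube m S. \<Sum>a=1..m. \<Sum>b=1..m. W' (x(i := a)) (y(i := b)) * H (x(i := a)) (y(i := b)))"
      unfolding sum_cube_insert[OF S(2)] by (intro sum.cong refl sum.swap)
    also have "\<dots> = (\<Sum>x\<in>cube m S. \<Sum>y\<in>cube m S. W x y * (\<Sum>a=1..m. \<Sum>b=1..m. J x y a b * H (x(i := a)) (y(i := b))))"
      unfolding sum_distrib_left by (intro sum.cong refl) (simp only: W'_upd mult.assoc)
    finally show ?thesis .
  qed
  have "coupling m \<eta> B1 B2 (insert i S) W'"
    unfolding coupling_def
  proof (intro conjI ballI allI)
    fix x y assume "x \<in> cube m (insert i S)" "y \<in> cube m (insert i S)"
    then show "0 \<le> W' x y" unfolding W'_def using W1 J1 rc by simp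
  next
    fix x assume x: "x \<in> cube m (insert i S)"
    have "(\<Sum>y\<in>cube m (insert i S). W' x y) = (\<Sum>y\<in>cube m S. \<Sum>b=1..m. W' ((r x)(i := x i)) (y(i := b)))"
      unfolding sum_cube_insert[OF S(2)] rc(3)[OF x] ..
    also have "\<dots> = (\<Sum>y\<in>cube m S. W (r x) y * (\<Sum>b=1..m. J (r x) y (x i) b))"
      unfolding sum_distrib_left using rc(1)[OF x] by (intro sum.cong refl W'_upd)
    also have "\<dots> = (\<Sum>y\<in>cube m S. W (r x) y * q (r x) (x i))"
      using rc(1,2)[OF x] by (intro sum.cong refl) (simp only: J2)
    also have "\<dots> = marg B1 S (r x) * q (r x) (x i)"
      unfolding sum_distrib_right[symmetric] W2[OF rc(1)[OF x]] ..
    also have "\<dots> = marg B1 (insert i S) x"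
      unfolding c1(3)[OF rc(1)[OF x] rc(2)[OF x]] rc(3)[OF x] ..
    finally show "(\<Sum>y\<in>cube m (insert i S). W' x y) = marg B1 (insert i S) x" .
  next
    fix y assume y: "y \<in> cube m (insert i S)"
    have "(\<Sum>x\<in>cube m (insert i S). W' x y) = (\<Sum>x\<in>cube m S. \<Sum>a=1..m. W' (x(i := a)) ((r y)(i := y i)))"
      unfolding sum_cube_insert[OF S(2)] rc(3)[OF y] ..
    also have "\<dots> = (\<Sum>x\<in>cube m S. W x (r y) * (\<Sum>a=1..m. J x (r y) a (y i)))"
      unfolding sum_distrib_left using rc(1)[OF y] by (intro sum.cong refl W'_upd)
    also have "\<dots> = (\<Sum>x\<in>cube m S. W x (r y) * q' (r y) (y i))"
      using rc(1,2)[OF y] by (intro sum.cong refl) (simp only: J3)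
    also have "\<dots> = marg B2 S (r y) * q' (r y) (y i)"
      unfolding sum_distrib_right[symmetric] W3[OF rc(1)[OF y]] ..
    also have "\<dots> = marg B2 (insert i S) y"
      unfolding c2(3)[OF rc(1)[OF y] rc(2)[OF y]] rc(3)[OF y] ..
    finally show "(\<Sum>x\<in>cube m (insert i S). W' x y) = marg B2 (insert i S) y" .
  next
    fix F G :: "(nat \<Rightarrow> nat) \<Rightarrow> real"
    define f where "f x = (\<Sum>a=1..m. q x a * F (x(i := a)))" for x
    define g where "g y = (\<Sum>b=1..m. q' y b * G (y(i := b)))" for y
    define vf where "vf x = (\<Sum>a=1..m. q x a * (F (x(i := a)))\<^sup>2) - (f x)\<^sup>2" for x
    define vg where "vg y = (\<Sum>b=1..m. q' y b * (G (y(i := b)))\<^sup>2) - (g y)\<^sup>2" for y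
    have mf: "mean m B1 (insert i S) F = mean m B1 S f"
      unfolding mean_insert[OF B1(1) S(2) B1(2) m] f_def q_def ..
    have mg: "mean m B2 (insert i S) G = mean m B2 S g"
      unfolding mean_insert[OF B2(1) S(2) B2(2) m] g_def q'_def ..
    have vf: "mean m B1 S vf = mean m B1 (insert i S) (\<lambda>x. (F x)\<^sup>2) - mean m B1 S (\<lambda>x. (f x)\<^sup>2)"
      unfolding vf_def mean_diff mean_insert[OF B1(1) S(2) B1(2) m] q_def ..
    have vg: "mean m B2 S vg = mean m B2 (insert i S) (\<lambda>x. (G x)\<^sup>2) - mean m B2 S (\<lambda>x. (g x)\<^sup>2)"
      unfolding vg_def mean_diff mean_insert[OF B2(1) S(2) B2(2) m] q'_def ..
    have "(\<Sum>x\<in>cube m (insert i S). \<Sum>y\<in>cube m (insert i S). W' x y * (F x * G y))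
      = (\<Sum>x\<in>cube m S. \<Sum>y\<in>cube m S. W x y * (\<Sum>a=1..m. \<Sum>b=1..m. J x y a b * (F (x(i := a)) * G (y(i := b)))))"
      by (rule expand)
    also have "\<dots> \<le> (\<Sum>x\<in>cube m S. \<Sum>y\<in>cube m S. W x y * (f x * g y + \<eta> * (vf x + vg y)))"
      unfolding f_def g_def vf_def vg_def
      by (intro sum_mono mult_left_mono J5 W1)
    also have "\<dots> = (\<Sum>x\<in>cube m S. \<Sum>y\<in>cube m S. W x y * (f x * g y) + \<eta> * (W x y * vf x) + \<eta> * (W x y * vg y))"
      by (simp add: algebra_simps)
    also have "\<dots> = (\<Sum>x\<in>cube m S. \<Sum>y\<in>cube m S. W x y * (f x * g y))
       + \<eta> * (\<Sum>x\<in>cube m S. \<Sum>y\<in>cube m S. W x y * vf x) + \<eta> * (\<Sum>x\<in>cube m S. \<Sum>y\<in>cube m S. W x y * vg y)"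
      by (simp only: sum.distrib sum_distrib_left)
    also have "(\<Sum>x\<in>cube m S. \<Sum>y\<in>cube m S. W x y * vf x) = mean m B1 S vf"
      unfolding sum_distrib_right[symmetric] mean_def by (intro sum.cong refl) (simp only: W2)
    also have "(\<Sum>x\<in>cube m S. \<Sum>y\<in>cube m S. W x y * vg y) = mean m B2 S vg"
      unfolding mean_def by (subst sum.swap, unfold sum_distrib_right[symmetric], intro sum.cong refl) (simp only: W3)
    also have "(\<Sum>x\<in>cube m S. \<Sum>y\<in>cube m S. W x y * (f x * g y)) + \<eta> * mean m B1 S vf + \<eta> * mean m B2 S vg
      \<le> mean m B1 S f * mean m B2 S g + \<eta> * (var m B1 S f + var m B2 S g) + \<eta> * mean m B1 S vf + \<eta> * mean m B2 S vg"
      using W4[of f g] by simp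
    \<comment> \<open>Law of total variance: the variances of the conditional means \<open>f\<close>
      and \<open>g\<close> and the averaged conditional variances \<open>vf\<close> and
      \<open>vg\<close> add up to the variances on \<open>insert i S\<close>.\<close>
    also have "\<dots> = mean m B1 (insert i S) F * mean m B2 (insert i S) G
        + \<eta> * (var m B1 (insert i S) F + var m B2 (insert i S) G)"
      unfolding var_def mf mg vf vg by (simp add: algebra_simps)
    finally show "(\<Sum>x\<in>cube m (insert i S). \<Sum>y\<in>cube m (insert i S). W' x y * (F x * G y))
      \<le> mean m B1 (insert i S) F * mean m B2 (insert i S) G
        + \<eta> * (var m B1 (insert i S) F + var m B2 (insert i S) G)" .
  qed
  moreover have "(\<Sum>x\<in>cube m (insert i S). \<Sum>y\<in>cube m (insert i S). W' x y * of_bool (\<exists>j\<in>insert i S. x j = y j))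
     \<le> (\<Sum>x\<in>cube m S. \<Sum>y\<in>cube m S. W x y * of_bool (\<exists>j\<in>S. x j = y j))
       + (\<Sum>a=1..m. \<Sum>x\<in>cube m S. \<Sum>y\<in>cube m S. W x y * (q x a * q' y a
            * (of_bool (\<eta> < q x a) + of_bool (\<eta> < q' y a))))"
  proof -
    let ?h = "\<lambda>x y a. q x a * q' y a * (of_bool (\<eta> < q x a) + of_bool (\<eta> < q' y a))"
    have "(\<Sum>a=1..m. \<Sum>b=1..m. J x y a b * of_bool (\<exists>j\<in>insert i S. (x(i := a)) j = (y(i := b)) j))
       \<le> of_bool (\<exists>j\<in>S. x j = y j) + (\<Sum>a=1..m. ?h x y a)" if xy: "x \<in> cube m S" "y \<in> cube m S" for x y
    proof -
      have "(\<exists>j\<in>insert i S. (x(i := a)) j = (y(i := b)) j) \<longleftrightarrow> a = b \<or> (\<exists>j\<in>S. x j = y j)" for a b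
        using S(2) by auto
      \<comment> \<open>Union bound: the pair agreed before, or it agrees at \<open>i\<close> and is
        counted by the diagonal of \<open>J x y\<close>.\<close>
      then have "(\<Sum>a=1..m. \<Sum>b=1..m. J x y a b * of_bool (\<exists>j\<in>insert i S. (x(i := a)) j = (y(i := b)) j))
        \<le> (\<Sum>a=1..m. \<Sum>b=1..m. J x y a b * of_bool (\<exists>j\<in>S. x j = y j) + (if a = b then J x y a b else 0))"
        using J1[OF xy] by (intro sum_mono) auto
      also have "\<dots> = (\<Sum>a=1..m. (\<Sum>b=1..m. J x y a b)) * of_bool (\<exists>j\<in>S. x j = y j) + (\<Sum>a=1..m. J x y a a)"
        by (simp add: sum.distrib sum_distrib_right)
      also have "(\<Sum>a=1..m. (\<Sum>b=1..m. J x y a b)) = (\<Sum>a=1..m. q x a)"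
        by (intro sum.cong refl J2[OF xy])
      also have "\<dots> = 1" by (rule c1(2)[OF xy(1)])
      also have "(\<Sum>a=1..m. J x y a a) \<le> (\<Sum>a=1..m. ?h x y a)"
        by (intro sum_mono J4[OF xy])
      finally show ?thesis by simp
    qed
    then have "(\<Sum>x\<in>cube m (insert i S). \<Sum>y\<in>cube m (insert i S). W' x y * of_bool (\<exists>j\<in>insert i S. x j = y j))
      \<le> (\<Sum>x\<in>cube m S. \<Sum>y\<in>cube m S. W x y * (of_bool (\<exists>j\<in>S. x j = y j) + (\<Sum>a=1..m. ?h x y a)))"
      unfolding expand by (intro sum_mono mult_left_mono W1)
    also have "\<dots> = (\<Sum>x\<in>cube m S. \<Sum>y\<in>cube m S. W x y * of_bool (\<exists>j\<in>S. x j = y j))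
       + (\<Sum>x\<in>cube m S. \<Sum>y\<in>cube m S. \<Sum>a=1..m. W x y * ?h x y a)"
      by (simp only: distrib_left sum.distrib sum_distrib_left)
    also have "(\<Sum>x\<in>cube m S. \<Sum>y\<in>cube m S. \<Sum>a=1..m. W x y * ?h x y a)
       = (\<Sum>x\<in>cube m S. \<Sum>a=1..m. \<Sum>y\<in>cube m S. W x y * ?h x y a)"
      by (intro sum.cong refl sum.swap)
    also have "\<dots> = (\<Sum>a=1..m. \<Sum>x\<in>cube m S. \<Sum>y\<in>cube m S. W x y * ?h x y a)"
      by (rule sum.swap)
    finally show ?thesis .
  qed
  ultimately show ?thesis using that unfolding q_def q'_def by blast
qed

text \<open>An agreement at symbol \<open>a\<close> needs \<open>a\<close> to be heavy for one family given its own past. The small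
  correlation decouples this from the conditional probability of \<open>a\<close> for the other family, whose mean is
  at most \<open>\<beta>\<close>; all sums that occur are controlled by the entropy increments.\<close>

lemma heavy_agreement_cost:
  assumes S: "finite S" "i \<notin> S" and m: "0 < m" and \<eta>: "2 / m \<le> \<eta>" "\<eta> \<le> 1/4" and \<beta>: "0 \<le> \<beta>"
    and B1: "finite B1" "B1 \<noteq> {}" "\<forall>y\<in>B1. \<forall>j\<in>insert i S. y j \<in> {1..m}" "\<forall>a\<in>{1..m}. freq B1 i a \<le> \<beta>"
    and B2: "finite B2" "B2 \<noteq> {}" "\<forall>y\<in>B2. \<forall>j\<in>insert i S. y j \<in> {1..m}" "\<forall>a\<in>{1..m}. freq B2 i a \<le> \<beta>"
    and W: "coupling m \<eta> B1 B2 S W"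
  shows "(\<Sum>a=1..m. \<Sum>x\<in>cube m S. \<Sum>y\<in>cube m S. W x y * (cond_marg m B1 S i x a * cond_marg m B2 S i y a
            * (of_bool (\<eta> < cond_marg m B1 S i x a) + of_bool (\<eta> < cond_marg m B2 S i y a))))
    \<le> 4 * (4 * \<beta> / \<eta> + 5 * \<eta>) * (rel_ent m B1 (insert i S) - rel_ent m B1 S + (rel_ent m B2 (insert i S) - rel_ent m B2 S))"
proof -
  define q where "q = cond_marg m B1 S i"
  define q' where "q' = cond_marg m B2 S i"
  define v where "v a = mean m B1 S (\<lambda>x. (q x a - 1 / m)\<^sup>2)" for a
  define v' where "v' a = mean m B2 S (\<lambda>x. (q' x a - 1 / m)\<^sup>2)" for a
  define K where "K = 4 * \<beta> / \<eta> + 5 * \<eta>"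
  have \<eta>0: "0 < \<eta>" using \<eta>(1) m by (smt (verit) divide_pos_pos of_nat_0_less_iff)
  have K0: "0 \<le> K" unfolding K_def using \<beta> \<eta>0 by simp
  note W4 = W[unfolded coupling_def, THEN conjunct2, THEN conjunct2, THEN conjunct2, rule_format]
  \<comment> \<open>A heavy \<open>u\<close> exceeds \<eta>, which is at least \<open>2 / m\<close>,
    so \<open>u - 1 / m\<close> is at least half of \<open>u\<close>.\<close>
  have sq: "(u * of_bool (\<eta> < u))\<^sup>2 \<le> 4 * (u - 1 / m)\<^sup>2" and ln: "u * of_bool (\<eta> < u) \<le> 4 / \<eta> * (u - 1 / m)\<^sup>2" for u :: real
  proof -
    have "(u * of_bool (\<eta> < u))\<^sup>2 \<le> 4 * (u - 1 / m)\<^sup>2 \<and> u * of_bool (\<eta> < u) \<le> 4 / \<eta> * (u - 1 / m)\<^sup>2"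
    proof (cases "\<eta> < u")
      case True
      then have u: "0 \<le> u" "u \<le> 2 * (u - 1 / m)" using \<eta>0 \<eta>(1) by (auto simp: field_simps)
      then have 1: "u\<^sup>2 \<le> 4 * (u - 1 / m)\<^sup>2" using power_mono[OF u(2) u(1), of 2] unfolding power_mult_distrib by simp
      have "\<eta> * u \<le> u\<^sup>2" using True u by (simp add: power2_eq_square mult_right_mono)
      with 1 have "\<eta> * u \<le> 4 * (u - 1 / m)\<^sup>2" by linarith
      then have "u \<le> 4 / \<eta> * (u - 1 / m)\<^sup>2" using \<eta>0 by (simp add: field_simps)
      with 1 True show ?thesis by simp
    qed (use \<eta>0 in auto)
    then show "(u * of_bool (\<eta> < u))\<^sup>2 \<le> 4 * (u - 1 / m)\<^sup>2" "u * of_bool (\<eta> < u) \<le> 4 / \<eta> * (u - 1 / m)\<^sup>2" by auto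
  qed
  have bound: "(\<Sum>x\<in>cube m S. \<Sum>y\<in>cube m S. W x y * (q x a * q' y a * (of_bool (\<eta> < q x a) + of_bool (\<eta> < q' y a))))
     \<le> K * (v a + v' a)" if a: "a \<in> {1..m}" for a
  proof -
    define h where "h x = q x a * of_bool (\<eta> < q x a)" for x
    define h' where "h' y = q' y a * of_bool (\<eta> < q' y a)" for y
    have q0: "0 \<le> q x a" if "x \<in> cube m S" for x
      unfolding q_def using B1 m S that by (intro cond_marg_properties(1)) auto
    have q'0: "0 \<le> q' x a" if "x \<in> cube m S" for x
      unfolding q'_def using B2 m S that by (intro cond_marg_properties(1)) auto
    have v0: "0 \<le> v a" "0 \<le> v' a" unfolding v_def v'_def by (auto intro!: mean_nonneg)
    have mq: "mean m B1 S (\<lambda>x. q x a) \<le> \<beta>" "mean m B2 S (\<lambda>x. q' x a) \<le> \<beta>"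
      unfolding q_def q'_def using mean_cond_marg[OF S(1) B1(1) S(2) B1(3) m a] mean_cond_marg[OF S(1) B2(1) S(2) B2(3) m a] B1(4) B2(4) a by auto
    have mq0: "0 \<le> mean m B1 S (\<lambda>x. q x a)" "0 \<le> mean m B2 S (\<lambda>x. q' x a)"
      using q0 q'0 by (auto intro!: mean_nonneg)
    have mh: "mean m B1 S h \<le> 4 / \<eta> * v a" "mean m B2 S h' \<le> 4 / \<eta> * v' a"
      unfolding v_def v'_def mean_cmult[symmetric] h_def h'_def by (intro mean_mono ln)+
    have mh0: "0 \<le> mean m B1 S h" "0 \<le> mean m B2 S h'"
      unfolding h_def h'_def using q0 q'0 by (auto intro!: mean_nonneg)
    have vq: "var m B1 S (\<lambda>x. q x a) \<le> v a" "var m B2 S (\<lambda>x. q' x a) \<le> v' a"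
      unfolding v_def v'_def using S B1 B2 by (auto intro!: var_le_mean_square)
    have vh: "var m B1 S h \<le> 4 * v a" "var m B2 S h' \<le> 4 * v' a"
    proof -
      have "var m B1 S h \<le> mean m B1 S (\<lambda>x. (h x)\<^sup>2)" "var m B2 S h' \<le> mean m B2 S (\<lambda>x. (h' x)\<^sup>2)"
        unfolding var_def by auto
      moreover have "mean m B1 S (\<lambda>x. (h x)\<^sup>2) \<le> 4 * v a" "mean m B2 S (\<lambda>x. (h' x)\<^sup>2) \<le> 4 * v' a"
        unfolding v_def v'_def mean_cmult[symmetric] h_def h'_def by (intro mean_mono sq)+
      ultimately show "var m B1 S h \<le> 4 * v a" "var m B2 S h' \<le> 4 * v' a" by auto
    qed
    \<comment> \<open>One sum for each family that may find \<open>a\<close> heavy. In each, the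
      correlation bound separates the truncated probability of one family from the full one of the
      other.\<close>
    have "(\<Sum>x\<in>cube m S. \<Sum>y\<in>cube m S. W x y * (q x a * q' y a * (of_bool (\<eta> < q x a) + of_bool (\<eta> < q' y a))))
      = (\<Sum>x\<in>cube m S. \<Sum>y\<in>cube m S. W x y * (h x * q' y a)) + (\<Sum>x\<in>cube m S. \<Sum>y\<in>cube m S. W x y * (q x a * h' y))"
      unfolding h_def h'_def by (simp add: algebra_simps sum.distrib)
    also have "\<dots> \<le> (mean m B1 S h * mean m B2 S (\<lambda>x. q' x a) + \<eta> * (var m B1 S h + var m B2 S (\<lambda>x. q' x a)))
        + (mean m B1 S (\<lambda>x. q x a) * mean m B2 S h' + \<eta> * (var m B1 S (\<lambda>x. q x a) + var m B2 S h'))"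
      by (intro add_mono W4)
    \<comment> \<open>Products of means give \<open>4 * \<beta> / \<eta>\<close>. Each of
      \<open>v a\<close> and \<open>v' a\<close> enters the variances once with factor 4, through
      the truncated function, and once with factor 1, whence \<open>5 * \<eta>\<close>.\<close>
    also have "\<dots> \<le> (4 / \<eta> * v a * \<beta> + \<eta> * (4 * v a + v' a)) + (\<beta> * (4 / \<eta> * v' a) + \<eta> * (v a + 4 * v' a))"
      using mh mh0 mq mq0 vh vq v0 \<beta> \<eta>0 by (intro add_mono mult_mono mult_left_mono) auto
    also have "\<dots> = K * (v a + v' a)" unfolding K_def by (simp add: algebra_simps add_divide_distrib)
    finally show ?thesis .
  qed
  have "(\<Sum>a=1..m. v a) \<le> 4 * (rel_ent m B1 (insert i S) - rel_ent m B1 S)"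
    unfolding v_def mean_def q_def using S B1 m by (intro variance_le_rel_ent) auto
  moreover have "(\<Sum>a=1..m. v' a) \<le> 4 * (rel_ent m B2 (insert i S) - rel_ent m B2 S)"
    unfolding v'_def mean_def q'_def using S B2 m by (intro variance_le_rel_ent) auto
  ultimately have v: "(\<Sum>a=1..m. v a) + (\<Sum>a=1..m. v' a) \<le> 4 * (rel_ent m B1 (insert i S) - rel_ent m B1 S + (rel_ent m B2 (insert i S) - rel_ent m B2 S))"
    by simp
  have "(\<Sum>a=1..m. \<Sum>x\<in>cube m S. \<Sum>y\<in>cube m S. W x y * (q x a * q' y a * (of_bool (\<eta> < q x a) + of_bool (\<eta> < q' y a))))
    \<le> (\<Sum>a=1..m. K * (v a + v' a))"
    by (intro sum_mono bound)
  also have "\<dots> = K * ((\<Sum>a=1..m. v a) + (\<Sum>a=1..m. v' a))"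
    by (simp add: sum_distrib_left sum.distrib algebra_simps)
  also have "\<dots> \<le> K * (4 * (rel_ent m B1 (insert i S) - rel_ent m B1 S + (rel_ent m B2 (insert i S) - rel_ent m B2 S)))"
    using v K0 by (rule mult_left_mono)
  finally show ?thesis unfolding q_def q'_def K_def by (simp only: mult.assoc mult.left_commute)
qed

text \<open>Each added coordinate costs a fixed multiple of the entropy increments of the two
  families, and these telescope.\<close>

lemma coupling_exists:
  assumes m: "0 < m" and \<eta>: "2 / m \<le> \<eta>" "\<eta> \<le> 1/4" and \<beta>: "0 \<le> \<beta>" and "finite S"
    and B1: "finite B1" "B1 \<noteq> {}" and B2: "finite B2" "B2 \<noteq> {}"
    and "\<forall>i\<in>S. (\<forall>y\<in>B1. y i \<in> {1..m}) \<and> (\<forall>y\<in>B2. y i \<in> {1..m}) \<and> (\<forall>a\<in>{1..m}. freq B1 i a \<le> \<beta> \<and> freq B2 i a \<le> \<beta>)"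
  shows "\<exists>W. coupling m \<eta> B1 B2 S W \<and>
    (\<Sum>x\<in>cube m S. \<Sum>y\<in>cube m S. W x y * of_bool (\<exists>j\<in>S. x j = y j))
      \<le> 4 * (4 * \<beta> / \<eta> + 5 * \<eta>) * (rel_ent m B1 S + rel_ent m B2 S)"
  using assms(5,10)
proof (induction S rule: finite_induct)
  case empty
  \<comment> \<open>The cube on no coordinates is a single point, so the coupling is the constant
    1.\<close>
  show ?case
    using B1 B2 by (intro exI[of _ "\<lambda>_ _. 1"])
      (simp add: coupling_def marg_empty mean_def var_def rel_ent_empty)
next
  case (insert i S)
  then obtain W where W: "coupling m \<eta> B1 B2 S W"
    "(\<Sum>x\<in>cube m S. \<Sum>y\<in>cube m S. W x y * of_bool (\<exists>j\<in>S. x j = y j))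
      \<le> 4 * (4 * \<beta> / \<eta> + 5 * \<eta>) * (rel_ent m B1 S + rel_ent m B2 S)" by blast
  have \<eta>0: "0 < \<eta>" using \<eta>(1) m by (smt (verit) divide_pos_pos of_nat_0_less_iff)
  have r: "\<forall>y\<in>B1. y i \<in> {1..m}" "\<forall>y\<in>B2. y i \<in> {1..m}"
    "\<forall>y\<in>B1. \<forall>j\<in>insert i S. y j \<in> {1..m}" "\<forall>y\<in>B2. \<forall>j\<in>insert i S. y j \<in> {1..m}"
    "\<forall>a\<in>{1..m}. freq B1 i a \<le> \<beta>" "\<forall>a\<in>{1..m}. freq B2 i a \<le> \<beta>"
    using insert.prems by blast+
  obtain W' where W': "coupling m \<eta> B1 B2 (insert i S) W'"
    "(\<Sum>x\<in>cube m (insert i S). \<Sum>y\<in>cube m (insert i S). W' x y * of_bool (\<exists>j\<in>insert i S. x j = y j))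
     \<le> (\<Sum>x\<in>cube m S. \<Sum>y\<in>cube m S. W x y * of_bool (\<exists>j\<in>S. x j = y j))
       + (\<Sum>a=1..m. \<Sum>x\<in>cube m S. \<Sum>y\<in>cube m S. W x y * (cond_marg m B1 S i x a * cond_marg m B2 S i y a
            * (of_bool (\<eta> < cond_marg m B1 S i x a) + of_bool (\<eta> < cond_marg m B2 S i y a))))"
    by (rule coupling_step[OF insert.hyps m \<eta>0 \<eta>(2) B1(1) r(1) B2(1) r(2) W(1)])
  note W'(2)
  also have "\<dots> \<le> 4 * (4 * \<beta> / \<eta> + 5 * \<eta>) * (rel_ent m B1 S + rel_ent m B2 S)
      + 4 * (4 * \<beta> / \<eta> + 5 * \<eta>) * (rel_ent m B1 (insert i S) - rel_ent m B1 S + (rel_ent m B2 (insert i S) - rel_ent m B2 S))"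
    by (intro add_mono W(2) heavy_agreement_cost insert.hyps m \<eta> \<beta> B1 B2 r W(1))
  also have "\<dots> = 4 * (4 * \<beta> / \<eta> + 5 * \<eta>) * (rel_ent m B1 (insert i S) + rel_ent m B2 (insert i S))"
    by (simp only: distrib_left[symmetric]) simp
  finally show ?case using W'(1) by blast
qed

text \<open>If every two members agreed somewhere on \<open>S\<close>, the coupling would be carried
  by agreeing prefixes, and its agreement probability would be 1 rather than below 1.\<close>

lemma disagreeing_pair:
  assumes m: "0 < m" and \<eta>: "2 / m \<le> \<eta>" "\<eta> \<le> 1/4" and \<beta>: "0 \<le> \<beta>" and S: "finite S"
    and B1: "finite B1" "B1 \<noteq> {}" and B2: "finite B2" "B2 \<noteq> {}"
    and i: "\<forall>i\<in>S. (\<forall>y\<in>B1. y i \<in> {1..m}) \<and> (\<forall>y\<in>B2. y i \<in> {1..m}) \<and> (\<forall>a\<in>{1..m}. freq B1 i a \<le> \<beta> \<and> freq B2 i a \<le> \<beta>)"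
    and small: "4 * (4 * \<beta> / \<eta> + 5 * \<eta>) * (rel_ent m B1 S + rel_ent m B2 S) < 1"
  shows "\<exists>x\<in>B1. \<exists>y\<in>B2. \<forall>j\<in>S. x j \<noteq> y j"
proof (rule ccontr)
  assume no: "\<not> ?thesis"
  obtain W where W: "coupling m \<eta> B1 B2 S W"
    "(\<Sum>x\<in>cube m S. \<Sum>y\<in>cube m S. W x y * of_bool (\<exists>j\<in>S. x j = y j))
      \<le> 4 * (4 * \<beta> / \<eta> + 5 * \<eta>) * (rel_ent m B1 S + rel_ent m B2 S)"
    using coupling_exists[OF m \<eta> \<beta> S B1 B2 i] by (elim exE conjE)
  note W1 = W(1)[unfolded coupling_def, THEN conjunct1, rule_format]
  note W2 = W(1)[unfolded coupling_def, THEN conjunct2, THEN conjunct1, rule_format]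
  note W3 = W(1)[unfolded coupling_def, THEN conjunct2, THEN conjunct2, THEN conjunct1, rule_format]
  have key: "W x y * of_bool (\<exists>j\<in>S. x j = y j) = W x y" if xy: "x \<in> cube m S" "y \<in> cube m S" for x y
  proof (cases "\<exists>j\<in>S. x j = y j")
    case False
    \<comment> \<open>A zero marginal forces the weight to vanish. With both marginals positive, the
      prefixes extend to members of \<open>B1\<close> and \<open>B2\<close> that disagree on all of
      \<open>S\<close>, against the assumption.\<close>
    have "W x y = 0"
    proof (cases "marg B1 S x = 0 \<or> marg B2 S y = 0")
      case True
      then show ?thesis
      proof
        assume "marg B1 S x = 0"
        then have "(\<Sum>y\<in>cube m S. W x y) = 0" using W2[OF xy(1)] by simp
        then show ?thesis using sum_nonneg_0[of "cube m S" "W x" y] W1[OF xy(1)] xy(2) finite_cube[OF S] by blast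
      next
        assume "marg B2 S y = 0"
        then have "(\<Sum>x\<in>cube m S. W x y) = 0" using W3[OF xy(2)] by simp
        then show ?thesis using sum_nonneg_0[of "cube m S" "\<lambda>x. W x y" x] W1[OF _ xy(2)] xy(1) finite_cube[OF S] by blast
      qed
    next
      case nonzero: False
      then have "{z \<in> B1. restrict z S = x} \<noteq> {}" "{z \<in> B2. restrict z S = y} \<noteq> {}"
        unfolding marg_def by (metis card.empty div_0 of_nat_0)+
      then obtain z1 z2 where z: "z1 \<in> B1" "restrict z1 S = x" "z2 \<in> B2" "restrict z2 S = y" by blast
      have "z1 j \<noteq> z2 j" if "j \<in> S" for j
        using False that unfolding z(2,4)[symmetric] by (metis restrict_apply')
      with z(1,3) no show ?thesis by blast
    qed
    then show ?thesis by simp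
  qed simp
  have "(\<Sum>x\<in>cube m S. \<Sum>y\<in>cube m S. W x y * of_bool (\<exists>j\<in>S. x j = y j)) = (\<Sum>x\<in>cube m S. \<Sum>y\<in>cube m S. W x y)"
    by (intro sum.cong refl key)
  also have "\<dots> = (\<Sum>x\<in>cube m S. marg B1 S x)" by (intro sum.cong refl W2)
  also have "\<dots> = 1" by (rule sum_marg[OF S B1]) (use i in blast)
  finally show False using W(2) small by linarith
qed

section \<open>Finding restrictions\<close>

text \<open>Restricted families are kept as sets of functions on all the original coordinates; \<open>L\<close> is the set
  of coordinates that are still free.\<close>

definition fibred :: "nat \<Rightarrow> nat set \<Rightarrow> (nat \<Rightarrow> nat) set \<Rightarrow> bool" where
  "fibred m L B \<longleftrightarrow> finite L \<and> finite B \<and> (\<forall>y\<in>B. \<forall>i\<in>L. y i \<in> {1..m}) \<and> inj_on (\<lambda>y. restrict y L) B"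

text \<open>As members of \<open>B\<close> are determined on \<open>L\<close>, the third conjunct
  bounds the density of \<open>B\<close> in the cube on \<open>L\<close> from below by
  \<open>1 / real m ^ K\<close>.\<close>

definition dense_global :: "nat \<Rightarrow> nat set \<Rightarrow> nat \<Rightarrow> real \<Rightarrow> (nat \<Rightarrow> nat) set \<Rightarrow> bool" where
  "dense_global m L K \<beta> B \<longleftrightarrow> fibred m L B \<and> B \<noteq> {} \<and> real m ^ card L \<le> real (card B) * real m ^ K
     \<and> (\<forall>i\<in>L. \<forall>a\<in>{1..m}. freq B i a \<le> \<beta>)"

text \<open>Members of the fibre are told apart by their restrictions to
  \<open>L - S\<close>.\<close>

lemma card_fibre_le:
  assumes "fibred m L B" "S \<subseteq> L"
  shows "card {y \<in> B. \<forall>i\<in>S. y i = x i} \<le> m ^ (card L - card S)"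
proof -
  have L: "finite L" "finite S" "finite B" using assms finite_subset unfolding fibred_def by auto
  have "inj_on (\<lambda>y. restrict y (L - S)) {y \<in> B. \<forall>i\<in>S. y i = x i}"
  proof (rule inj_onI)
    fix y z
    assume yz: "y \<in> {y \<in> B. \<forall>i\<in>S. y i = x i}" "z \<in> {y \<in> B. \<forall>i\<in>S. y i = x i}"
      and eq: "restrict y (L - S) = restrict z (L - S)"
    have "y i = z i" if "i \<in> L" for i
      using yz fun_cong[OF eq, of i] that by (cases "i \<in> S") auto
    then have "restrict y L = restrict z L" by (auto simp: fun_eq_iff)
    then show "y = z" using assms(1) yz unfolding fibred_def inj_on_def by blast
  qed
  moreover have "(\<lambda>y. restrict y (L - S)) ` {y \<in> B. \<forall>i\<in>S. y i = x i} \<subseteq> cube m (L - S)"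
    using assms(1) unfolding fibred_def cube_def by (intro image_subsetI) (simp only: restrict_PiE_iff, blast)
  ultimately have "card {y \<in> B. \<forall>i\<in>S. y i = x i} \<le> card (cube m (L - S))"
    using L by (intro card_inj_on_le) auto
  then show ?thesis using L assms(2) by (simp add: card_cube card_Diff_subset)
qed

text \<open>A prefix has at most \<open>m ^ (card L - card S)\<close> extensions, so the density of
  the marginal law relative to uniform is pointwise at most \<open>M\<close>; average the
  logarithm.\<close>

lemma rel_ent_le:
  assumes "fibred m L B" "B \<noteq> {}" "S \<subseteq> L" "0 < m" "real m ^ card L \<le> real (card B) * M"
  shows "rel_ent m B S \<le> ln M"
proof -
  have L: "finite L" "finite S" "finite B" using assms finite_subset unfolding fibred_def by auto
  have cB: "0 < real (card B)" using L assms(2) by (simp add: card_gt_0_iff)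
  have M: "0 < M"
  proof -
    have "0 < real m ^ card L" using assms(4) by simp
    then have "0 < real (card B) * M" using assms(5) by linarith
    then show ?thesis using cB by (simp add: zero_less_mult_iff)
  qed
  have "marg B S x * ln (marg B S x * real m ^ card S) \<le> marg B S x * ln M" for x
  proof (cases "marg B S x = 0")
    case False
    then have pos: "0 < marg B S x" by (simp add: less_le)
    have "{y \<in> B. restrict y S = x} \<subseteq> {y \<in> B. \<forall>i\<in>S. y i = x i}" by auto
    then have "card {y \<in> B. restrict y S = x} \<le> card {y \<in> B. \<forall>i\<in>S. y i = x i}"
      using L(3) by (intro card_mono) auto
    also have "\<dots> \<le> m ^ (card L - card S)" by (rule card_fibre_le[OF assms(1,3)])
    finally have "card {y \<in> B. restrict y S = x} \<le> m ^ (card L - card S)" .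
    then have "real (card {y \<in> B. restrict y S = x}) \<le> real m ^ (card L - card S)"
      by (metis of_nat_le_iff of_nat_power)
    then have "real (card {y \<in> B. restrict y S = x}) * real m ^ card S \<le> real m ^ (card L - card S) * real m ^ card S"
      by (intro mult_right_mono) auto
    also have "\<dots> = real m ^ card L" using card_mono[OF L(1) assms(3)] by (simp flip: power_add)
    finally have "marg B S x * real m ^ card S \<le> M"
      using assms(5) cB unfolding marg_def by (simp add: pos_divide_le_eq mult.commute)
    then show ?thesis using pos assms(4) by (intro mult_left_mono ln_mono) auto
  qed simp
  then have "rel_ent m B S \<le> (\<Sum>x\<in>cube m S. marg B S x * ln M)"
    unfolding rel_ent_def by (intro sum_mono)
  also have "\<dots> = (\<Sum>x\<in>cube m S. marg B S x) * ln M" by (simp add: sum_distrib_right)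
  also have "(\<Sum>x\<in>cube m S. marg B S x) = 1"
    by (rule sum_marg[OF L(2,3) assms(2)]) (use assms(1,3) in \<open>unfold fibred_def, blast\<close>)
  finally show ?thesis by simp
qed

lemma rel_ent_le_dense_global:
  assumes "dense_global m L K \<beta> B" "S \<subseteq> L" "0 < m"
  shows "rel_ent m B S \<le> real K * ln m"
  using rel_ent_le[of m L B S "real m ^ K"] assms by (simp add: dense_global_def ln_realpow)

text \<open>With \<beta> of order \<open>1 / sqrt m\<close>, the choice
  \<open>\<eta> = 1 / sqrt (sqrt m)\<close> balances \<open>\<beta> / \<eta>\<close> against \<eta>.
  Both have order \<open>1 / sqrt (sqrt m)\<close>, which beats the entropy bound of order
  \<open>ln m\<close>.\<close>

lemma eventually_disagreeing_pair:
  "\<forall>\<^sub>F m in sequentially. \<forall>L1 L2 B1 B2. dense_global m L1 K (2 / sqrt m) B1 \<longrightarrow> dense_global m L2 K (2 / sqrt m) B2 \<longrightarrow>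
     (\<exists>x\<in>B1. \<exists>y\<in>B2. \<forall>j\<in>L1 \<inter> L2. x j \<noteq> y j)"
proof -
  define k where "k = real K"
  have "\<forall>\<^sub>F m in sequentially. 2 / real m \<le> 1 / sqrt (sqrt m)" by real_asymp
  moreover have "\<forall>\<^sub>F m in sequentially. 1 / sqrt (sqrt (real m)) \<le> 1/4" by real_asymp
  moreover have "\<forall>\<^sub>F m in sequentially. 4 * (4 * (2 / sqrt (real m)) / (1 / sqrt (sqrt m)) + 5 * (1 / sqrt (sqrt m))) * (k * ln m + k * ln m) < 1"
    by real_asymp
  moreover have "\<forall>\<^sub>F m in sequentially. (0::nat) < m" by (rule eventually_gt_at_top)
  ultimately show ?thesis
  proof eventually_elim
    case (elim m)
    show ?case
    proof (intro allI impI)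
      fix L1 L2 B1 B2 assume d: "dense_global m L1 K (2 / sqrt m) B1" "dense_global m L2 K (2 / sqrt m) B2"
      have f: "finite L1" "finite B1" "B1 \<noteq> {}" "finite B2" "B2 \<noteq> {}"
        using d unfolding dense_global_def fibred_def by blast+
      let ?c = "4 * (4 * (2 / sqrt (real m)) / (1 / sqrt (sqrt m)) + 5 * (1 / sqrt (sqrt m)))"
      have "?c * (rel_ent m B1 (L1 \<inter> L2) + rel_ent m B2 (L1 \<inter> L2)) \<le> ?c * (k * ln m + k * ln m)"
        unfolding k_def using elim d by (intro mult_left_mono add_mono rel_ent_le_dense_global) auto
      then have small: "?c * (rel_ent m B1 (L1 \<inter> L2) + rel_ent m B2 (L1 \<inter> L2)) < 1" using elim(3) by linarith
      show "\<exists>x\<in>B1. \<exists>y\<in>B2. \<forall>j\<in>L1 \<inter> L2. x j \<noteq> y j"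
        by (rule disagreeing_pair[OF elim(4,1,2) _ _ f(2-5) _ small])
          (use f d in \<open>auto simp: dense_global_def fibred_def\<close>)
    qed
  qed
qed

section \<open>Coordinates and values that can be fixed in both families\<close>

text \<open>The sets of smaller coordinates form a chain from the empty set to \<open>L\<close>.
  This and its mirror image below let the chain rule run in both orders.\<close>

lemma sum_telescope_less:
  fixes g :: "nat set \<Rightarrow> real"
  assumes "finite L"
  shows "(\<Sum>i\<in>L. g (insert i {j \<in> L. j < i}) - g {j \<in> L. j < i}) = g L - g {}"
  using assms
proof (induction L rule: finite_linorder_max_induct)
  case (insert b A)
  have "{j \<in> insert b A. j < i} = {j \<in> A. j < i}" if "i \<in> A" for i using insert(2) that by auto
  moreover have "{j \<in> insert b A. j < b} = A" using insert(2) by auto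
  moreover have "b \<notin> A" using insert(2) by auto
  ultimately show ?case using insert by simp
qed simp

lemma sum_telescope_greater:
  fixes g :: "nat set \<Rightarrow> real"
  assumes "finite L"
  shows "(\<Sum>i\<in>L. g (insert i {j \<in> L. i < j}) - g {j \<in> L. i < j}) = g L - g {}"
  using assms
proof (induction L rule: finite_linorder_min_induct)
  case (insert b A)
  have "{j \<in> insert b A. i < j} = {j \<in> A. i < j}" if "i \<in> A" for i using insert(2) that by auto
  moreover have "{j \<in> insert b A. b < j} = A" using insert(2) by auto
  moreover have "b \<notin> A" using insert(2) by auto
  ultimately show ?case using insert by simp
qed simp

text \<open>Average \<open>\<ell>\<^sub>1\<close>-distance from uniform of coordinate \<open>i\<close> given the coordinates in \<open>S\<close>.\<close>

definition deviation :: "nat \<Rightarrow> (nat \<Rightarrow> nat) set \<Rightarrow> nat set \<Rightarrow> nat \<Rightarrow> real" where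
  "deviation m B S i = (\<Sum>a=1..m. \<Sum>x\<in>cube m S. \<bar>marg B (insert i S) (x(i := a)) - marg B S x / m\<bar>)"

text \<open>Summed over the past, the signed deviation at \<open>a\<close> is
  \<open>freq B i a - 1 / m\<close>; hence each rare value contributes at least
  \<open>1 / (2 * m)\<close> to the total deviation.\<close>

lemma card_rare_le:
  assumes "finite S" "finite B" "B \<noteq> {}" "i \<notin> S" "\<forall>y\<in>B. \<forall>j\<in>S. y j \<in> {1..m}" "0 < m"
  shows "real (card {a \<in> {1..m}. freq B i a < 1 / (2 * real m)}) \<le> 2 * real m * deviation m B S i"
proof -
  let ?Z = "{a \<in> {1..m}. freq B i a < 1 / (2 * real m)}"
  have "real (card ?Z) * (1 / (2 * real m)) = (\<Sum>a\<in>?Z. 1 / (2 * real m))" by simp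
  also have "\<dots> \<le> (\<Sum>a\<in>?Z. \<Sum>x\<in>cube m S. \<bar>marg B (insert i S) (x(i := a)) - marg B S x / m\<bar>)"
  proof (rule sum_mono)
    fix a assume a: "a \<in> ?Z"
    have "(\<Sum>x\<in>cube m S. marg B (insert i S) (x(i := a)) - marg B S x / m) = freq B i a - 1 / m"
      using sum_marg_coordinate[OF assms(1,2,4,5), of a] sum_marg[OF assms(1-3,5)]
      by (simp add: sum_subtractf flip: sum_divide_distrib)
    then have "1 / m - freq B i a \<le> (\<Sum>x\<in>cube m S. \<bar>marg B (insert i S) (x(i := a)) - marg B S x / m\<bar>)"
      using sum_abs[of "\<lambda>x. marg B (insert i S) (x(i := a)) - marg B S x / m" "cube m S"] by linarith
    moreover have "1 / (2 * real m) + 1 / (2 * real m) = 1 / m" by simp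
    ultimately show "1 / (2 * real m) \<le> (\<Sum>x\<in>cube m S. \<bar>marg B (insert i S) (x(i := a)) - marg B S x / m\<bar>)"
      using a by auto
  qed
  also have "\<dots> \<le> deviation m B S i"
    unfolding deviation_def by (intro sum_mono2) (auto intro: sum_nonneg)
  finally show ?thesis using assms(6) by (simp add: field_simps)
qed

text \<open>If the coordinates in \<open>S\<close> barely influence coordinate \<open>i\<close>, then fixing \<open>x i = a\<close> cannot, for many
  \<open>a\<close>, make one of them concentrate on a single value.\<close>

lemma card_correlated_le:
  assumes "finite S" "finite B" "B \<noteq> {}" "i \<notin> S" "\<forall>y\<in>B. \<forall>j\<in>S. y j \<in> {1..m}" "0 < m" "0 < c" "0 \<le> \<beta>"
    and \<beta>: "\<forall>l\<in>S. \<forall>b\<in>{1..m}. freq B l b \<le> \<beta>"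
  shows "real (card {a \<in> {1..m}. 1 / (2 * real m) \<le> freq B i a \<and>
      (\<exists>l\<in>S. \<exists>b\<in>{1..m}. c * real (card {y \<in> B. y i = a}) < real (card {y \<in> B. y i = a \<and> y l = b}))})
    \<le> 2 * real m / c * (\<beta> + deviation m B S i)"
proof -
  let ?T = "{a \<in> {1..m}. 1 / (2 * real m) \<le> freq B i a \<and>
      (\<exists>l\<in>S. \<exists>b\<in>{1..m}. c * real (card {y \<in> B. y i = a}) < real (card {y \<in> B. y i = a \<and> y l = b}))}"
  let ?d = "\<lambda>a. \<Sum>x\<in>cube m S. \<bar>marg B (insert i S) (x(i := a)) - marg B S x / m\<bar>"
  have cB: "0 < real (card B)" using assms(2,3) by (simp add: card_gt_0_iff)
  have "real (card ?T) * (c / (2 * real m)) = (\<Sum>a\<in>?T. c / (2 * real m))" by simp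
  also have "\<dots> \<le> (\<Sum>a\<in>?T. \<beta> / m + ?d a)"
  proof (rule sum_mono)
    fix a assume a: "a \<in> ?T"
    then obtain l b where lb: "l \<in> S" "b \<in> {1..m}"
      "c * real (card {y \<in> B. y i = a}) < real (card {y \<in> B. y i = a \<and> y l = b})" by blast
    have "c / (2 * real m) \<le> c * freq B i a"
      using a assms(7) mult_left_mono[of "1 / (2 * real m)" "freq B i a" c] by simp
    also have "\<dots> \<le> real (card {y \<in> B. y i = a \<and> y l = b}) / real (card B)"
      using lb(3) cB unfolding freq_def by (simp add: divide_right_mono less_imp_le)
    also have "{y \<in> B. y i = a \<and> y l = b} = {y \<in> B. y i = a \<and> restrict y S l = b}"
      using lb(1) by auto
    also have "real (card {y \<in> B. y i = a \<and> restrict y S l = b}) / real (card B)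
      = (\<Sum>x\<in>{x \<in> cube m S. x l = b}. marg B (insert i S) (x(i := a)))"
      by (rule sum_marg_insert[symmetric, OF assms(1,2,4,5)])
    \<comment> \<open>Compare with coordinate \<open>i\<close> uniform and independent of the past:
      the main part is the frequency of \<open>b\<close> at \<open>l\<close> divided by
      \<open>m\<close>, and the error is part of the deviation at \<open>a\<close>.\<close>
    also have "\<dots> \<le> (\<Sum>x\<in>{x \<in> cube m S. x l = b}. marg B S x / m + \<bar>marg B (insert i S) (x(i := a)) - marg B S x / m\<bar>)"
      by (rule sum_mono) linarith
    also have "\<dots> = (\<Sum>x\<in>{x \<in> cube m S. x l = b}. marg B S x) / m
        + (\<Sum>x\<in>{x \<in> cube m S. x l = b}. \<bar>marg B (insert i S) (x(i := a)) - marg B S x / m\<bar>)"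
      by (simp only: sum.distrib sum_divide_distrib)
    also have "\<dots> \<le> \<beta> / m + ?d a"
    proof (rule add_mono)
      have "(\<Sum>x\<in>{x \<in> cube m S. x l = b}. marg B S x) = real (card {y \<in> B. restrict y S l = b}) / real (card B)"
        by (rule sum_marg_filter[OF assms(1,2,5)])
      also have "\<dots> = freq B l b" using lb(1) unfolding freq_def by simp
      also have "\<dots> \<le> \<beta>" using \<beta> lb by blast
      finally show "(\<Sum>x\<in>{x \<in> cube m S. x l = b}. marg B S x) / m \<le> \<beta> / m"
        by (rule divide_right_mono) simp
      show "(\<Sum>x\<in>{x \<in> cube m S. x l = b}. \<bar>marg B (insert i S) (x(i := a)) - marg B S x / m\<bar>) \<le> ?d a"
        using assms(1) by (intro sum_mono2) auto
    qed
    finally show "c / (2 * real m) \<le> \<beta> / m + ?d a" .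
  qed
  also have "\<dots> \<le> (\<Sum>a=1..m. \<beta> / m + ?d a)"
    using assms(8) by (intro sum_mono2) (auto intro!: add_nonneg_nonneg sum_nonneg)
  also have "\<dots> = \<beta> + deviation m B S i" using assms(6) unfolding deviation_def by (simp add: sum.distrib)
  finally show ?thesis using assms(6,7) by (simp add: field_simps)
qed

text \<open>The threshold \<open>1 / (2 * m)\<close> is half the uniform frequency, so fixing
  \<open>y i = a\<close> costs at most a factor 2 in density. The second clause says that no further
  single value captures more than a share \<open>c\<close> of the restricted family.\<close>

definition restrictable :: "nat \<Rightarrow> nat set \<Rightarrow> real \<Rightarrow> (nat \<Rightarrow> nat) set \<Rightarrow> nat \<Rightarrow> nat \<Rightarrow> bool" where
  "restrictable m L c B i a \<longleftrightarrow> 1 / (2 * real m) \<le> freq B i a \<and>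
     (\<forall>l\<in>L - {i}. \<forall>b\<in>{1..m}. real (card {y \<in> B. y i = a \<and> y l = b}) \<le> c * real (card {y \<in> B. y i = a}))"

lemma deviation_le_rel_ent_diff:
  assumes "fibred m L B" "B \<noteq> {}" "S \<subseteq> L - {i}" "i \<in> L" "0 < m" "0 < t"
  shows "deviation m B S i \<le> (rel_ent m B (insert i S) - rel_ent m B S) / (4 * t) + 4 * t"
  unfolding deviation_def
  by (rule deviation_le_rel_ent) (use assms finite_subset in \<open>auto simp: fibred_def\<close>)

text \<open>Four times the increment dominates a weighted sum of squares.\<close>

lemma rel_ent_mono:
  assumes "fibred m L B" "S \<subseteq> L - {i}" "i \<in> L" "0 < m"
  shows "rel_ent m B S \<le> rel_ent m B (insert i S)"
proof -
  have "(\<Sum>a=1..m. \<Sum>x\<in>cube m S. marg B S x * (cond_marg m B S i x a - 1 / m)\<^sup>2)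
    \<le> 4 * (rel_ent m B (insert i S) - rel_ent m B S)"
    by (rule variance_le_rel_ent) (use assms finite_subset in \<open>auto simp: fibred_def\<close>)
  moreover have "0 \<le> (\<Sum>a=1..m. \<Sum>x\<in>cube m S. marg B S x * (cond_marg m B S i x a - 1 / m)\<^sup>2)"
    by (intro sum_nonneg mult_nonneg_nonneg) auto
  ultimately have "0 \<le> 4 * (rel_ent m B (insert i S) - rel_ent m B S)" by (rule order_trans[rotated])
  then show ?thesis by simp
qed

text \<open>Since entropy increments are nonnegative, the sum over \<open>I\<close> may be enlarged
  to \<open>L\<close>, where it telescopes to at most \<open>K * ln m\<close>. The sets
  \<open>S i\<close> stand for the coordinates before \<open>i\<close> or those after
  \<open>i\<close>.\<close>

lemma sum_deviation_le:
  fixes t :: real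
  assumes "dense_global m L K \<beta> B" "I \<subseteq> L" "0 < m" "0 < t"
    and S: "\<And>i. i \<in> L \<Longrightarrow> S i \<subseteq> L - {i}"
    and tel: "(\<Sum>i\<in>L. rel_ent m B (insert i (S i)) - rel_ent m B (S i)) = rel_ent m B L - rel_ent m B {}"
  shows "(\<Sum>i\<in>I. deviation m B (S i) i) \<le> K * ln m / (4 * t) + 4 * t * card I"
proof -
  have f: "fibred m L B" "B \<noteq> {}" "finite L" "finite B" using assms(1) unfolding dense_global_def fibred_def by auto
  have "(\<Sum>i\<in>I. deviation m B (S i) i) \<le> (\<Sum>i\<in>I. (rel_ent m B (insert i (S i)) - rel_ent m B (S i)) / (4 * t) + 4 * t)"
  proof (rule sum_mono)
    fix i assume "i \<in> I"
    then have i: "i \<in> L" using assms(2) by blast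
    show "deviation m B (S i) i \<le> (rel_ent m B (insert i (S i)) - rel_ent m B (S i)) / (4 * t) + 4 * t"
      by (rule deviation_le_rel_ent_diff[OF f(1,2) S[OF i] i assms(3,4)])
  qed
  also have "\<dots> = (\<Sum>i\<in>I. rel_ent m B (insert i (S i)) - rel_ent m B (S i)) / (4 * t) + 4 * t * card I"
    by (simp add: sum.distrib flip: sum_divide_distrib)
  also have "(\<Sum>i\<in>I. rel_ent m B (insert i (S i)) - rel_ent m B (S i)) \<le> (\<Sum>i\<in>L. rel_ent m B (insert i (S i)) - rel_ent m B (S i))"
    using f(3) assms(2,3) S rel_ent_mono[OF f(1)] by (intro sum_mono2) auto
  also have "\<dots> \<le> K * ln m"
    unfolding tel using rel_ent_le_dense_global[OF assms(1) order_refl assms(3)] rel_ent_empty[OF f(4,2)] by simp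
  finally show ?thesis using assms(4) by (simp add: divide_right_mono)
qed

text \<open>A coordinate correlated with \<open>i\<close> lies before or after \<open>i\<close>, so the chain rule is used in both orders.\<close>

lemma sum_not_restrictable_le:
  fixes t :: real
  assumes d: "dense_global m L K \<beta> B" and "I \<subseteq> L" "0 < m" "0 < t" "0 < c" "0 \<le> \<beta>"
  shows "(\<Sum>i\<in>I. real (card {a \<in> {1..m}. \<not> restrictable m L c B i a}))
    \<le> m * ((2 + 4 / c) * (K * ln m / (4 * t) + 4 * t * card I) + 4 * \<beta> / c * card I)"
proof -
  have f: "fibred m L B" "B \<noteq> {}" "finite L" "finite B" using d unfolding dense_global_def fibred_def by auto
  let ?A = "\<lambda>i. {j \<in> L. j < i}" and ?D = "\<lambda>i. {j \<in> L. i < j}"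
  let ?K = "K * ln m / (4 * t) + 4 * t * card I"
  have "real (card {a \<in> {1..m}. \<not> restrictable m L c B i a})
     \<le> 2 * real m * deviation m B (?A i) i + 2 * real m / c * (\<beta> + deviation m B (?A i) i) + 2 * real m / c * (\<beta> + deviation m B (?D i) i)"
    if i: "i \<in> L" for i
  proof -
    let ?Z = "{a \<in> {1..m}. freq B i a < 1 / (2 * real m)}"
    let ?T = "\<lambda>S. {a \<in> {1..m}. 1 / (2 * real m) \<le> freq B i a \<and>
      (\<exists>l\<in>S. \<exists>b\<in>{1..m}. c * real (card {y \<in> B. y i = a}) < real (card {y \<in> B. y i = a \<and> y l = b}))}"
    have "{a \<in> {1..m}. \<not> restrictable m L c B i a} \<subseteq> ?Z \<union> ?T (?A i) \<union> ?T (?D i)"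
    proof
      fix a assume a: "a \<in> {a \<in> {1..m}. \<not> restrictable m L c B i a}"
      show "a \<in> ?Z \<union> ?T (?A i) \<union> ?T (?D i)"
      proof (cases "freq B i a < 1 / (2 * real m)")
        case False
        with a have "\<not> (\<forall>l\<in>L - {i}. \<forall>b\<in>{1..m}. real (card {y \<in> B. y i = a \<and> y l = b}) \<le> c * real (card {y \<in> B. y i = a}))"
          unfolding restrictable_def not_less by blast
        then obtain l b where lb: "l \<in> L - {i}" "b \<in> {1..m}"
          "c * real (card {y \<in> B. y i = a}) < real (card {y \<in> B. y i = a \<and> y l = b})"
          unfolding not_le[symmetric] by blast
        from lb(1) have "l \<in> ?A i \<or> l \<in> ?D i" by auto
        then show ?thesis using False a lb(2,3) unfolding not_less by blast
      qed (use a in blast)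
    qed
    then have "card {a \<in> {1..m}. \<not> restrictable m L c B i a} \<le> card (?Z \<union> ?T (?A i) \<union> ?T (?D i))"
      by (intro card_mono) auto
    also have "\<dots> \<le> card ?Z + card (?T (?A i)) + card (?T (?D i))"
      using card_Un_le[of "?Z \<union> ?T (?A i)" "?T (?D i)"] card_Un_le[of ?Z "?T (?A i)"] by linarith
    finally have "real (card {a \<in> {1..m}. \<not> restrictable m L c B i a})
      \<le> real (card ?Z) + real (card (?T (?A i))) + real (card (?T (?D i)))" by linarith
    moreover have "real (card ?Z) \<le> 2 * real m * deviation m B (?A i) i"
      using f assms by (intro card_rare_le) (auto simp: fibred_def)
    moreover have "real (card (?T (?A i))) \<le> 2 * real m / c * (\<beta> + deviation m B (?A i) i)"
      by (rule card_correlated_le) (use f assms in \<open>auto simp: fibred_def dense_global_def\<close>)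
    moreover have "real (card (?T (?D i))) \<le> 2 * real m / c * (\<beta> + deviation m B (?D i) i)"
      by (rule card_correlated_le) (use f assms in \<open>auto simp: fibred_def dense_global_def\<close>)
    ultimately show ?thesis by linarith
  qed
  then have "(\<Sum>i\<in>I. real (card {a \<in> {1..m}. \<not> restrictable m L c B i a}))
     \<le> (\<Sum>i\<in>I. 2 * real m * deviation m B (?A i) i + 2 * real m / c * (\<beta> + deviation m B (?A i) i) + 2 * real m / c * (\<beta> + deviation m B (?D i) i))"
    using assms(2) by (intro sum_mono) blast
  also have "\<dots> = 2 * real m * (\<Sum>i\<in>I. deviation m B (?A i) i) + 2 * real m / c * (\<beta> * card I + (\<Sum>i\<in>I. deviation m B (?A i) i))
      + 2 * real m / c * (\<beta> * card I + (\<Sum>i\<in>I. deviation m B (?D i) i))"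
    by (simp only: sum.distrib sum_distrib_left[symmetric] sum_constant) (simp add: mult.commute)
  also have "\<dots> \<le> 2 * real m * ?K + 2 * real m / c * (\<beta> * card I + ?K) + 2 * real m / c * (\<beta> * card I + ?K)"
    using assms(3-5)
    by (intro add_mono mult_left_mono sum_deviation_le[OF d assms(2-4)] sum_telescope_less sum_telescope_greater f(3) order_refl) auto
  also have "2 * real m * X + 2 * real m / c * (\<beta> * Y + X) + 2 * real m / c * (\<beta> * Y + X)
      = m * ((2 + 4 / c) * X + 4 * \<beta> / c * Y)" for X Y :: real
    using assms(5) by (simp add: field_simps)
  finally show ?thesis .
qed

text \<open>For each family, the average number of bad values per common coordinate is below
  \<open>m / 2\<close>; so at some coordinate the bad values of the two families together do not
  exhaust \<open>{1..m}\<close>.\<close>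

lemma eventually_restrictable:
  assumes "0 < c"
  obtains N :: nat where "0 < N" "\<forall>\<^sub>F m in sequentially. \<forall>L1 L2 B1 B2. dense_global m L1 K (2 / sqrt m) B1 \<longrightarrow>
     dense_global m L2 K (2 / sqrt m) B2 \<longrightarrow> real N * ln m \<le> card (L1 \<inter> L2) \<longrightarrow>
     (\<exists>i\<in>L1 \<inter> L2. \<exists>a\<in>{1..m}. restrictable m L1 c B1 i a \<and> restrictable m L2 c B2 i a)"
proof -
  define C where "C = 2 + 4 / c"
  have C: "0 < C" unfolding C_def using assms by (simp add: add_pos_pos)
  \<comment> \<open>Budget of \<open>1 / 2\<close> per coordinate: this \<open>t\<close> makes its
    additive loss \<open>1 / 8\<close>, the choice of \<open>N\<close> bounds the entropy part by
    \<open>1 / 8\<close>, and for large \<open>m\<close> the frequency part is below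
    \<open>1 / 4\<close>.\<close>
  define t where "t = 1 / (32 * C)"
  have t: "0 < t" "C * (4 * t) = 1 / 8" unfolding t_def using C by auto
  obtain N :: nat where N: "C * K / (4 * t) * 8 < N" using reals_Archimedean2 by blast
  have N0: "0 < N"
  proof -
    have "0 \<le> C * K / (4 * t) * 8" using C t by simp
    then show ?thesis using N by (metis less_le_trans of_nat_0_less_iff le_less_trans)
  qed
  have "\<forall>\<^sub>F m in sequentially. 4 * (2 / sqrt (real m)) / c < 1/4" using assms by real_asymp
  moreover have "\<forall>\<^sub>F m in sequentially. (1::nat) < m" by (rule eventually_gt_at_top)
  ultimately have "\<forall>\<^sub>F m in sequentially. \<forall>L1 L2 B1 B2. dense_global m L1 K (2 / sqrt m) B1 \<longrightarrow>
     dense_global m L2 K (2 / sqrt m) B2 \<longrightarrow> real N * ln m \<le> card (L1 \<inter> L2) \<longrightarrow>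
     (\<exists>i\<in>L1 \<inter> L2. \<exists>a\<in>{1..m}. restrictable m L1 c B1 i a \<and> restrictable m L2 c B2 i a)"
  proof eventually_elim
    case (elim m)
    show ?case
    proof (intro allI impI)
      fix L1 L2 B1 B2
      assume d: "dense_global m L1 K (2 / sqrt m) B1" "dense_global m L2 K (2 / sqrt m) B2"
        and I: "real N * ln m \<le> card (L1 \<inter> L2)"
      let ?I = "L1 \<inter> L2"
      have "0 < ln (real m)" using elim(2) by simp
      then have "0 < real N * ln m" using N0 by simp
      then have I0: "0 < real (card ?I)" using I by linarith
      have half: "(\<Sum>i\<in>?I. real (card {a \<in> {1..m}. \<not> restrictable m L c B i a})) < m * (card ?I / 2)"
        if "dense_global m L K (2 / sqrt m) B" "?I \<subseteq> L" for L B
      proof -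
        have "(\<Sum>i\<in>?I. real (card {a \<in> {1..m}. \<not> restrictable m L c B i a}))
           \<le> m * (C * (K * ln m / (4 * t) + 4 * t * card ?I) + 4 * (2 / sqrt m) / c * card ?I)"
          unfolding C_def by (rule sum_not_restrictable_le[OF that _ t(1) assms]) (use elim(2) in auto)
        also have "\<dots> < m * (card ?I / 2)"
        proof -
          have "C * K / (4 * t) * 8 * ln m \<le> real N * ln m"
            using N \<open>0 < ln (real m)\<close> by (intro mult_right_mono) auto
          then have "C * (K * ln m / (4 * t)) \<le> card ?I / 8" using I by (simp add: field_simps)
          moreover have "C * (4 * t * card ?I) = card ?I / 8" using t(2) by (simp add: mult.assoc[symmetric])
          moreover have "4 * (2 / sqrt m) / c * card ?I < 1 / 4 * card ?I"
            using elim(1) I0 by (intro mult_strict_right_mono)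
          ultimately have "C * (K * ln m / (4 * t) + 4 * t * card ?I) + 4 * (2 / sqrt m) / c * card ?I < card ?I / 2"
            unfolding distrib_left by linarith
          then show ?thesis using elim(2) by (intro mult_strict_left_mono) auto
        qed
        finally show ?thesis .
      qed
      show "\<exists>i\<in>?I. \<exists>a\<in>{1..m}. restrictable m L1 c B1 i a \<and> restrictable m L2 c B2 i a"
      proof (rule ccontr)
        assume no: "\<not> ?thesis"
        have "real m \<le> real (card {a \<in> {1..m}. \<not> restrictable m L1 c B1 i a}) + real (card {a \<in> {1..m}. \<not> restrictable m L2 c B2 i a})"
          if "i \<in> ?I" for i
        proof -
          have "{1..m} \<subseteq> {a \<in> {1..m}. \<not> restrictable m L1 c B1 i a} \<union> {a \<in> {1..m}. \<not> restrictable m L2 c B2 i a}"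
            using no that by blast
          from card_mono[OF _ this] have "m \<le> card ({a \<in> {1..m}. \<not> restrictable m L1 c B1 i a} \<union> {a \<in> {1..m}. \<not> restrictable m L2 c B2 i a})" by simp
          also have "\<dots> \<le> card {a \<in> {1..m}. \<not> restrictable m L1 c B1 i a} + card {a \<in> {1..m}. \<not> restrictable m L2 c B2 i a}"
            by (rule card_Un_le)
          finally show ?thesis by linarith
        qed
        then have "(\<Sum>i\<in>?I. real m) \<le> (\<Sum>i\<in>?I. real (card {a \<in> {1..m}. \<not> restrictable m L1 c B1 i a}) + real (card {a \<in> {1..m}. \<not> restrictable m L2 c B2 i a}))"
          by (rule sum_mono)
        also have "\<dots> < m * (card ?I / 2) + m * (card ?I / 2)"
          unfolding sum.distrib using half[OF d(1)] half[OF d(2)] by (intro add_strict_mono) auto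
        finally show False by simp
      qed
    qed
  qed
  with N0 show ?thesis by (rule that)
qed

section \<open>Dense global fibres of uncapturable families\<close>

text \<open>A pair \<open>(i, a)\<close> stands for the dictator \<open>y i = a\<close>. The strict
  inequality is the negation of capturability; for empty \<open>E\<close> it is a lower bound on the
  density of \<open>B\<close>.\<close>

definition uncapturable_fibred :: "nat \<Rightarrow> nat set \<Rightarrow> nat \<Rightarrow> nat \<Rightarrow> (nat \<Rightarrow> nat) set \<Rightarrow> bool" where
  "uncapturable_fibred m L r k B \<longleftrightarrow> fibred m L B \<and>
     (\<forall>E. E \<subseteq> L \<times> {1..m} \<longrightarrow> card E \<le> r \<longrightarrow>
        real m ^ card L < real (card {y \<in> B. \<forall>(i, a)\<in>E. y i \<noteq> a}) * real m ^ k)"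

lemma fibred_subset: "fibred m L B \<Longrightarrow> B' \<subseteq> B \<Longrightarrow> fibred m L B'"
  unfolding fibred_def using inj_on_subset[of "\<lambda>y. restrict y L" B B'] finite_subset[of B' B] by blast

lemma fibred_fibre:
  assumes "fibred m L B"
  shows "fibred m (L - S) {y \<in> B. \<forall>i\<in>S. y i = \<alpha> i}"
proof -
  have "inj_on (\<lambda>y. restrict y (L - S)) {y \<in> B. \<forall>i\<in>S. y i = \<alpha> i}"
  proof (rule inj_onI)
    fix y z
    assume yz: "y \<in> {y \<in> B. \<forall>i\<in>S. y i = \<alpha> i}" "z \<in> {y \<in> B. \<forall>i\<in>S. y i = \<alpha> i}"
      and eq: "restrict y (L - S) = restrict z (L - S)"
    have "y i = z i" if "i \<in> L" for i
      using yz fun_cong[OF eq, of i] that by (cases "i \<in> S") auto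
    then have "restrict y L = restrict z L" by (auto simp: fun_eq_iff)
    then show "y = z" using assms yz unfolding fibred_def inj_on_def by blast
  qed
  moreover have "finite {y \<in> B. \<forall>i\<in>S. y i = \<alpha> i}" using assms unfolding fibred_def by simp
  ultimately show ?thesis using assms unfolding fibred_def by blast
qed

text \<open>Among the fibres whose density has grown by at least \<open>sqrt m\<close> per fixed coordinate, take one with
  the most fixed coordinates.\<close>

lemma global_fibre:
  assumes f: "fibred m L B" and m: "1 < m" and big: "real m ^ card L \<le> real (card B) * real m ^ k"
  obtains S \<alpha> where "S \<subseteq> L" "card S \<le> 2 * k"
    "real m ^ card (L - S) \<le> real (card {y \<in> B. \<forall>i\<in>S. y i = \<alpha> i}) * real m ^ k"
    "\<And>i a. i \<in> L - S \<Longrightarrow> freq {y \<in> B. \<forall>i\<in>S. y i = \<alpha> i} i a \<le> 1 / sqrt m"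
proof -
  let ?fib = "\<lambda>S \<alpha>. {y \<in> B. \<forall>i\<in>S. y i = \<alpha> i}"
  define P where "P S \<longleftrightarrow> S \<subseteq> L \<and> (\<exists>\<alpha>. sqrt m ^ card S * real m ^ card (L - S) \<le> real (card (?fib S \<alpha>)) * real m ^ k)" for S
  have fin: "finite L" "finite B" using f unfolding fibred_def by auto
  have "P {}" unfolding P_def using big by simp
  moreover have "\<forall>S. P S \<longrightarrow> card S < Suc (card L)"
    unfolding P_def less_Suc_eq_le by (intro allI impI card_mono[OF fin(1)]) (erule conjunct1)
  ultimately have "\<exists>S. P S \<and> (\<forall>S'. P S' \<longrightarrow> card S' \<le> card S)" by (rule ex_has_greatest_nat[where f = card])
  then obtain S where S: "P S" "\<forall>S'. P S' \<longrightarrow> card S' \<le> card S" by (elim exE conjE) (rule that)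
  from S(1) obtain \<alpha> where \<alpha>: "S \<subseteq> L" "sqrt m ^ card S * real m ^ card (L - S) \<le> real (card (?fib S \<alpha>)) * real m ^ k"
    unfolding P_def by (elim conjE exE) (rule that)
  have finS: "finite S" using \<alpha>(1) fin(1) by (rule finite_subset)
  have sq: "1 < sqrt m" "sqrt m * sqrt m = m" using m by auto
  show ?thesis
  proof (rule that)
    show "S \<subseteq> L" by (rule \<alpha>(1))
    \<comment> \<open>A fibre has density at most 1, so the total gain
      \<open>sqrt m ^ card S\<close> cannot exceed \<open>real m ^ k\<close>.\<close>
    have "card (?fib S \<alpha>) \<le> m ^ card (L - S)"
      using card_fibre_le[OF f \<alpha>(1), of \<alpha>] unfolding card_Diff_subset[OF finS \<alpha>(1)] .
    then have "real (card (?fib S \<alpha>)) \<le> real m ^ card (L - S)"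
      unfolding of_nat_power[symmetric] by (rule of_nat_mono)
    then have "real (card (?fib S \<alpha>)) * real m ^ k \<le> real m ^ card (L - S) * real m ^ k"
      by (rule mult_right_mono) simp
    then have "real m ^ card (L - S) * sqrt m ^ card S \<le> real m ^ card (L - S) * real m ^ k"
      using \<alpha>(2) by (simp add: mult.commute)
    then have "sqrt m ^ card S \<le> real m ^ k" using m by simp
    also have "real m ^ k = sqrt m ^ (2 * k)" using m by (simp add: power_mult)
    finally show "card S \<le> 2 * k" using sq(1) by simp
    have "1 * real m ^ card (L - S) \<le> sqrt m ^ card S * real m ^ card (L - S)"
      using sq(1) by (intro mult_right_mono one_le_power) auto
    then show "real m ^ card (L - S) \<le> real (card (?fib S \<alpha>)) * real m ^ k" using \<alpha>(2) by linarith
  next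
    fix i a assume i: "i \<in> L - S"
    show "freq (?fib S \<alpha>) i a \<le> 1 / sqrt m"
    proof (rule ccontr)
      assume "\<not> ?thesis"
      then have *: "1 / sqrt m < freq (?fib S \<alpha>) i a" by simp
      have "(\<forall>j\<in>insert i S. y j = (\<alpha>(i := a)) j) \<longleftrightarrow> (\<forall>j\<in>S. y j = \<alpha> j) \<and> y i = a" for y
        using i by auto
      then have eq: "?fib (insert i S) (\<alpha>(i := a)) = {y \<in> ?fib S \<alpha>. y i = a}" by blast
      have "real (card (?fib S \<alpha>)) \<noteq> 0"
      proof
        assume "real (card (?fib S \<alpha>)) = 0"
        then have "freq (?fib S \<alpha>) i a = 0" unfolding freq_def by simp
        moreover have "0 < 1 / sqrt m" using sq by simp
        ultimately show False using * by linarith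
      qed
      then have "0 < real (card (?fib S \<alpha>))" by linarith
      then have lt: "real (card (?fib S \<alpha>)) < sqrt m * real (card {y \<in> ?fib S \<alpha>. y i = a})"
        using * sq(1) unfolding freq_def by (simp add: divide_simps mult.commute)
      have Li: "card (L - S) = Suc (card (L - insert i S))"
      proof -
        have "L - insert i S = L - S - {i}" by auto
        then show ?thesis using card_Suc_Diff1[of "L - S" i] fin(1) i by simp
      qed
      \<comment> \<open>Fixing \<open>i\<close> as well shrinks the ambient cube by the factor
        \<open>m\<close> but the fibre by less than \<open>sqrt m\<close>: the density gains another
        \<open>sqrt m\<close>, against maximality of \<open>S\<close>.\<close>
      have "sqrt m * (sqrt m ^ card (insert i S) * real m ^ card (L - insert i S)) = sqrt m ^ card S * real m ^ card (L - S)"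
        using i finS sq(2) unfolding Li by (simp add: mult.assoc[symmetric])
      also have "\<dots> \<le> real (card (?fib S \<alpha>)) * real m ^ k" by (rule \<alpha>(2))
      also have "\<dots> \<le> sqrt m * real (card {y \<in> ?fib S \<alpha>. y i = a}) * real m ^ k"
        using lt by (intro mult_right_mono) auto
      finally have "sqrt m ^ card (insert i S) * real m ^ card (L - insert i S) \<le> real (card (?fib (insert i S) (\<alpha>(i := a)))) * real m ^ k"
        using sq(1) unfolding eq by (simp add: mult.assoc)
      then have "P (insert i S)" unfolding P_def using i \<alpha>(1) by blast
      from S(2)[rule_format, OF this] show False using i finS by simp
    qed
  qed
qed

text \<open>The second family first drops the at most \<open>2 * k\<close> dictators fixed for the
  first, which uncapturability permits. Values fixed for the second at coordinates free in the first
  have frequency at most \<open>1 / sqrt m\<close> there, so dropping them costs at most half of the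
  first fibre. This doubles the frequency bound and is paid for by one more power of
  \<open>m\<close>.\<close>

lemma globalize:
  assumes u: "uncapturable_fibred m L1 r k B1" "uncapturable_fibred m L2 r k B2" and r: "2 * k \<le> r" and m: "2 \<le> m" "4 * k \<le> sqrt m"
  obtains S1 S2 B1' B2' where "S1 \<subseteq> L1" "S2 \<subseteq> L2" "card S1 \<le> 2 * k" "card S2 \<le> 2 * k" "B1' \<subseteq> B1" "B2' \<subseteq> B2"
    "dense_global m (L1 - S1) (Suc k) (2 / sqrt m) B1'" "dense_global m (L2 - S2) (Suc k) (2 / sqrt m) B2'"
    "\<And>x y i. x \<in> B1' \<Longrightarrow> y \<in> B2' \<Longrightarrow> i \<in> L1 \<inter> L2 \<Longrightarrow> i \<in> S1 \<union> S2 \<Longrightarrow> x i \<noteq> y i"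
proof -
  have f: "fibred m L1 B1" "fibred m L2 B2" using u unfolding uncapturable_fibred_def by auto
  have fin: "finite L1" "finite L2" "finite B1" "finite B2" using f unfolding fibred_def by auto
  have m1: "1 < m" using m by simp
  have sq: "0 < sqrt m" using m by simp
  have "real m ^ card L1 \<le> real (card B1) * real m ^ k"
    using u(1)[unfolded uncapturable_fibred_def, THEN conjunct2, rule_format, of "{}"] by simp
  then obtain S1 \<alpha>1 where S1: "S1 \<subseteq> L1" "card S1 \<le> 2 * k"
    "real m ^ card (L1 - S1) \<le> real (card {y \<in> B1. \<forall>i\<in>S1. y i = \<alpha>1 i}) * real m ^ k"
    "\<And>i a. i \<in> L1 - S1 \<Longrightarrow> freq {y \<in> B1. \<forall>i\<in>S1. y i = \<alpha>1 i} i a \<le> 1 / sqrt m"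
    by (rule global_fibre[OF f(1) m1]) (simp only:)
  define F1 where "F1 = {y \<in> B1. \<forall>i\<in>S1. y i = \<alpha>1 i}"
  \<comment> \<open>The range condition makes the pairs genuine dictators. It loses no possible
    agreement, as members of \<open>B1\<close> only take values in \<open>{1..m}\<close> on
    \<open>L1\<close>.\<close>
  define E where "E = {(i, a). i \<in> S1 \<inter> L2 \<and> a = \<alpha>1 i \<and> a \<in> {1..m}}"
  have finS1: "finite S1" using S1(1) fin(1) by (rule finite_subset)
  have E: "E \<subseteq> L2 \<times> {1..m}" "card E \<le> r"
  proof -
    show "E \<subseteq> L2 \<times> {1..m}" unfolding E_def by auto
    have "E \<subseteq> (\<lambda>i. (i, \<alpha>1 i)) ` S1" unfolding E_def by auto
    then have "card E \<le> card S1" using finS1 by (rule surj_card_le[rotated])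
    then show "card E \<le> r" using S1(2) r by linarith
  qed
  define C2 where "C2 = {y \<in> B2. \<forall>(i, a)\<in>E. y i \<noteq> a}"
  have C2: "fibred m L2 C2" using f(2) by (rule fibred_subset) (auto simp: C2_def)
  have "real m ^ card L2 \<le> real (card C2) * real m ^ k"
    using u(2)[unfolded uncapturable_fibred_def, THEN conjunct2, rule_format, OF E] unfolding C2_def by simp
  then obtain S2 \<alpha>2 where S2: "S2 \<subseteq> L2" "card S2 \<le> 2 * k"
    "real m ^ card (L2 - S2) \<le> real (card {y \<in> C2. \<forall>i\<in>S2. y i = \<alpha>2 i}) * real m ^ k"
    "\<And>i a. i \<in> L2 - S2 \<Longrightarrow> freq {y \<in> C2. \<forall>i\<in>S2. y i = \<alpha>2 i} i a \<le> 1 / sqrt m"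
    by (rule global_fibre[OF C2 m1]) (simp only:)
  define B2' where "B2' = {y \<in> C2. \<forall>i\<in>S2. y i = \<alpha>2 i}"
  \<comment> \<open>Agreements at coordinates in \<open>S1\<close> are excluded by \<open>E\<close>;
    \<open>T\<close> collects the remaining coordinates where the second family is fixed and the
    first is free.\<close>
  define T where "T = S2 \<inter> (L1 - S1)"
  have T: "finite T" "card T \<le> 2 * k"
  proof -
    have "finite S2" using S2(1) fin(2) by (rule finite_subset)
    moreover from this have "card T \<le> card S2" unfolding T_def by (intro card_mono) auto
    ultimately show "finite T" "card T \<le> 2 * k" using S2(2) unfolding T_def by auto
  qed
  define B1' where "B1' = {y \<in> F1. \<forall>i\<in>T. y i \<noteq> \<alpha>2 i}"
  have F1: "fibred m (L1 - S1) F1" unfolding F1_def by (rule fibred_fibre[OF f(1)])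
  then have finF: "finite F1" unfolding fibred_def by simp
  have pos: "0 < real m ^ j" for j using m by simp
  have half: "real (card F1) \<le> 2 * real (card B1')"
  proof -
    have "F1 = B1' \<union> (\<Union>i\<in>T. {y \<in> F1. y i = \<alpha>2 i})" unfolding B1'_def by blast
    then have "card F1 = card (B1' \<union> (\<Union>i\<in>T. {y \<in> F1. y i = \<alpha>2 i}))" by (rule arg_cong)
    also have "\<dots> \<le> card B1' + card (\<Union>i\<in>T. {y \<in> F1. y i = \<alpha>2 i})" by (rule card_Un_le)
    also have "card (\<Union>i\<in>T. {y \<in> F1. y i = \<alpha>2 i}) \<le> (\<Sum>i\<in>T. card {y \<in> F1. y i = \<alpha>2 i})"
      using T(1) by (rule card_UN_le)
    finally have "card F1 \<le> card B1' + (\<Sum>i\<in>T. card {y \<in> F1. y i = \<alpha>2 i})" by simp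
    then have "real (card F1) \<le> real (card B1' + (\<Sum>i\<in>T. card {y \<in> F1. y i = \<alpha>2 i}))"
      by (simp only: of_nat_le_iff)
    then have "real (card F1) \<le> real (card B1') + (\<Sum>i\<in>T. real (card {y \<in> F1. y i = \<alpha>2 i}))"
      by (simp only: of_nat_add of_nat_sum)
    also have "(\<Sum>i\<in>T. real (card {y \<in> F1. y i = \<alpha>2 i})) \<le> (\<Sum>i\<in>T. real (card F1) / sqrt m)"
    proof (rule sum_mono)
      fix i assume "i \<in> T"
      then have "freq F1 i (\<alpha>2 i) \<le> 1 / sqrt m" unfolding F1_def T_def by (intro S1(4)) auto
      then have "real (card F1) * freq F1 i (\<alpha>2 i) \<le> real (card F1) * (1 / sqrt m)"
        by (rule mult_left_mono) simp
      then show "real (card {y \<in> F1. y i = \<alpha>2 i}) \<le> real (card F1) / sqrt m"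
        using finF unfolding freq_def by (cases "card F1 = 0") auto
    qed
    also have "\<dots> = real (card T) * (real (card F1) / sqrt m)" by simp
    also have "\<dots> \<le> (sqrt m / 2) * (real (card F1) / sqrt m)"
      using T(2) m sq by (intro mult_right_mono) auto
    also have "\<dots> = real (card F1) / 2" using sq by simp
    finally show ?thesis by simp
  qed
  have F1big: "real m ^ card (L1 - S1) \<le> real (card F1) * real m ^ k" using S1(3) unfolding F1_def .
  have F1pos: "0 < real (card F1)"
    using F1big pos[of "card (L1 - S1)"] by (cases "card F1 = 0") auto
  have F2pos: "0 < real (card B2')"
    using S2(3) pos[of "card (L2 - S2)"] unfolding B2'_def by (cases "card {y \<in> C2. \<forall>i\<in>S2. y i = \<alpha>2 i} = 0") auto
  have d1: "dense_global m (L1 - S1) (Suc k) (2 / sqrt m) B1'"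
    unfolding dense_global_def
  proof (intro conjI ballI)
    show "fibred m (L1 - S1) B1'" using F1 by (rule fibred_subset) (auto simp: B1'_def)
    show "B1' \<noteq> {}" using half F1pos by auto
    have "real (card F1) * real m ^ k \<le> 2 * real (card B1') * real m ^ k"
      using half by (intro mult_right_mono) auto
    also have "\<dots> \<le> m * real (card B1') * real m ^ k"
      using m by (intro mult_right_mono) auto
    finally show "real m ^ card (L1 - S1) \<le> real (card B1') * real m ^ Suc k"
      using F1big by (simp add: mult_ac)
  next
    fix i a assume "i \<in> L1 - S1" "a \<in> {1..m}"
    then have fr: "freq F1 i a \<le> 1 / sqrt m" unfolding F1_def by (intro S1(4))
    have "card {y \<in> B1'. y i = a} \<le> card {y \<in> F1. y i = a}"
      using finF unfolding B1'_def by (intro card_mono) auto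
    then have "freq B1' i a \<le> real (card {y \<in> F1. y i = a}) / real (card B1')"
      unfolding freq_def by (simp add: divide_right_mono)
    also have "\<dots> \<le> real (card {y \<in> F1. y i = a}) / (real (card F1) / 2)"
      using half F1pos by (intro divide_left_mono) auto
    also have "\<dots> = 2 * freq F1 i a" unfolding freq_def by simp
    also have "\<dots> \<le> 2 / sqrt m" using fr by simp
    finally show "freq B1' i a \<le> 2 / sqrt m" .
  qed
  have d2: "dense_global m (L2 - S2) (Suc k) (2 / sqrt m) B2'"
    unfolding dense_global_def
  proof (intro conjI ballI)
    show "fibred m (L2 - S2) B2'" unfolding B2'_def by (rule fibred_fibre[OF C2])
    show "B2' \<noteq> {}" using F2pos by auto
    have "real (card B2') * real m ^ k \<le> real (card B2') * real m ^ Suc k"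
      using m by (intro mult_left_mono power_increasing) auto
    then show "real m ^ card (L2 - S2) \<le> real (card B2') * real m ^ Suc k"
      using S2(3) unfolding B2'_def by linarith
  next
    fix i a assume "i \<in> L2 - S2" "a \<in> {1..m}"
    then have "freq B2' i a \<le> 1 / sqrt m" unfolding B2'_def by (intro S2(4))
    also have "\<dots> \<le> 2 / sqrt m" using sq by (simp add: divide_right_mono)
    finally show "freq B2' i a \<le> 2 / sqrt m" .
  qed
  show ?thesis
  proof (rule that[OF S1(1) S2(1) S1(2) S2(2) _ _ d1 d2])
    show "B1' \<subseteq> B1" "B2' \<subseteq> B2" unfolding B1'_def F1_def B2'_def C2_def by auto
  next
    fix x y i assume x: "x \<in> B1'" and y: "y \<in> B2'" and i: "i \<in> L1 \<inter> L2" "i \<in> S1 \<union> S2"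
    show "x i \<noteq> y i"
    proof (cases "i \<in> S1")
      case True
      then have xi: "x i = \<alpha>1 i" and "x \<in> B1" using x unfolding B1'_def F1_def by auto
      then have "\<alpha>1 i \<in> {1..m}" using f(1) i(1) unfolding fibred_def by (metis IntD1)
      then have "(i, \<alpha>1 i) \<in> E" unfolding E_def using True i(1) by auto
      then have "y i \<noteq> \<alpha>1 i" using y unfolding B2'_def C2_def by blast
      then show ?thesis using xi by simp
    next
      case False
      then have "i \<in> T" "y i = \<alpha>2 i" using i y unfolding T_def B2'_def by auto
      then show ?thesis using x unfolding B1'_def by auto
    qed
  qed
qed

text \<open>At most \<open>r\<close> dictators, each with a share of at most
  \<open>1 / (2 * (r + 1))\<close>, leave at least half of the restricted family. Together with the
  factor 2 lost by fixing \<open>i\<close>, the density drops by at most 4, which is less than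
  \<open>m\<close>.\<close>

lemma restrictable_imp_uncapturable_fibred:
  assumes d: "dense_global m L K \<beta> B" and i: "i \<in> L" and res: "restrictable m L (1 / (2 * (real r + 1))) B i a" and m: "4 < m"
  shows "uncapturable_fibred m (L - {i}) r (Suc K) {y \<in> B. y i = a}"
proof -
  let ?B = "{y \<in> B. y i = a}"
  have f: "fibred m L B" "finite L" "finite B" "B \<noteq> {}" using d unfolding dense_global_def fibred_def by auto
  have cB: "0 < real (card B)" using f by (simp add: card_gt_0_iff)
  have "fibred m (L - {i}) ?B" using fibred_fibre[OF f(1), of "{i}" "\<lambda>_. a"] by simp
  moreover have "real m ^ card (L - {i}) < real (card {y \<in> ?B. \<forall>(l, b)\<in>E. y l \<noteq> b}) * real m ^ Suc K"
    if E: "E \<subseteq> (L - {i}) \<times> {1..m}" "card E \<le> r" for E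
  proof -
    let ?C = "{y \<in> ?B. \<forall>(l, b)\<in>E. y l \<noteq> b}"
    have finE: "finite E" using finite_subset[OF E(1)] f(2) by simp
    have "?B = ?C \<union> (\<Union>(l, b)\<in>E. {y \<in> B. y i = a \<and> y l = b})" by blast
    then have "card ?B = card (?C \<union> (\<Union>(l, b)\<in>E. {y \<in> B. y i = a \<and> y l = b}))" by (rule arg_cong)
    also have "\<dots> \<le> card ?C + card (\<Union>(l, b)\<in>E. {y \<in> B. y i = a \<and> y l = b})" by (rule card_Un_le)
    also have "card (\<Union>(l, b)\<in>E. {y \<in> B. y i = a \<and> y l = b}) \<le> (\<Sum>(l, b)\<in>E. card {y \<in> B. y i = a \<and> y l = b})"
      using card_UN_le[OF finE, of "\<lambda>(l, b). {y \<in> B. y i = a \<and> y l = b}"] by (simp add: split_def)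
    finally have "card ?B \<le> card ?C + (\<Sum>(l, b)\<in>E. card {y \<in> B. y i = a \<and> y l = b})" by simp
    then have "real (card ?B) \<le> real (card ?C + (\<Sum>(l, b)\<in>E. card {y \<in> B. y i = a \<and> y l = b}))"
      by (simp only: of_nat_le_iff)
    then have "real (card ?B) \<le> real (card ?C) + (\<Sum>(l, b)\<in>E. real (card {y \<in> B. y i = a \<and> y l = b}))"
      by (simp only: of_nat_add of_nat_sum split_def)
    also have "(\<Sum>(l, b)\<in>E. real (card {y \<in> B. y i = a \<and> y l = b})) \<le> (\<Sum>z\<in>E. 1 / (2 * (real r + 1)) * real (card ?B))"
      using res E(1) unfolding restrictable_def by (intro sum_mono) auto
    also have "\<dots> = real (card E) * (1 / (2 * (real r + 1)) * real (card ?B))" by simp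
    also have "\<dots> \<le> (real r + 1) * (1 / (2 * (real r + 1)) * real (card ?B))"
      using E(2) by (intro mult_right_mono) auto
    also have "\<dots> = real (card ?B) / 2" by (simp add: field_simps)
    finally have C: "real (card ?B) \<le> 2 * real (card ?C)" by simp
    have "1 / (2 * real m) \<le> real (card ?B) / real (card B)" using res unfolding restrictable_def freq_def by simp
    then have "real (card B) \<le> 2 * real m * real (card ?B)" using cB m by (simp add: field_simps)
    also have "\<dots> \<le> 2 * real m * (2 * real (card ?C))" using C by (rule mult_left_mono) simp
    finally have "real (card B) \<le> 4 * real m * real (card ?C)" by simp
    then have "real (card B) * real m ^ K \<le> 4 * real m * real (card ?C) * real m ^ K"
      by (rule mult_right_mono) simp
    moreover have "real m ^ card L \<le> real (card B) * real m ^ K" using d unfolding dense_global_def by blast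
    moreover have "real m ^ card L = real m * real m ^ card (L - {i})"
      using card_Suc_Diff1[OF f(2) i] by (metis power_Suc)
    ultimately have "real m * real m ^ card (L - {i}) \<le> 4 * (real (card ?C) * real m ^ Suc K)"
      by (simp add: mult_ac)
    moreover have "4 * real m ^ card (L - {i}) < real m * real m ^ card (L - {i})"
      using m by (intro mult_strict_right_mono) auto
    ultimately show ?thesis by linarith
  qed
  ultimately show ?thesis unfolding uncapturable_fibred_def by blast
qed

section \<open>Induction on the number of agreements\<close>

text \<open>\<open>k\<close> is generalised because a step uses the hypothesis at
  \<open>k + 2\<close>: one power of \<open>m\<close> goes into \<open>globalize\<close> and one
  into fixing the agreement. The capturing parameter is \<open>2 * k\<close> at every stage; the
  \<open>r\<close> of the hypothesis enters through the share
  \<open>1 / (2 * (r + 1))\<close>.\<close>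

lemma eventually_agreement:
  "\<exists>r N :: nat. \<forall>\<^sub>F m in sequentially. \<forall>L1 L2 B1 B2. uncapturable_fibred m L1 r k B1 \<longrightarrow> uncapturable_fibred m L2 r k B2 \<longrightarrow>
     real N * ln m \<le> card (L1 \<inter> L2) \<longrightarrow> (\<exists>x\<in>B1. \<exists>y\<in>B2. card {i \<in> L1 \<inter> L2. x i = y i} = s)"
proof (induction s arbitrary: k)
  case 0
  have "\<forall>\<^sub>F m in sequentially. 4 * real k \<le> sqrt (real m)" by real_asymp
  then have "\<forall>\<^sub>F m in sequentially. \<forall>L1 L2 B1 B2. uncapturable_fibred m L1 (2 * k) k B1 \<longrightarrow> uncapturable_fibred m L2 (2 * k) k B2 \<longrightarrow>
     real 0 * ln m \<le> card (L1 \<inter> L2) \<longrightarrow> (\<exists>x\<in>B1. \<exists>y\<in>B2. card {i \<in> L1 \<inter> L2. x i = y i} = 0)"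
    using eventually_disagreeing_pair[of "Suc k"] eventually_ge_at_top[of "2::nat"]
  proof eventually_elim
    case (elim m)
    show ?case
    proof (intro allI impI)
      fix L1 L2 B1 B2 assume u: "uncapturable_fibred m L1 (2 * k) k B1" "uncapturable_fibred m L2 (2 * k) k B2"
      obtain S1 S2 B1' B2' where "S1 \<subseteq> L1" "S2 \<subseteq> L2" "card S1 \<le> 2 * k" "card S2 \<le> 2 * k" and g: "B1' \<subseteq> B1" "B2' \<subseteq> B2"
        "dense_global m (L1 - S1) (Suc k) (2 / sqrt m) B1'" "dense_global m (L2 - S2) (Suc k) (2 / sqrt m) B2'"
        "\<And>x y i. x \<in> B1' \<Longrightarrow> y \<in> B2' \<Longrightarrow> i \<in> L1 \<inter> L2 \<Longrightarrow> i \<in> S1 \<union> S2 \<Longrightarrow> x i \<noteq> y i"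
        by (rule globalize[OF u order_refl elim(3,1)]) (rule that)
      then obtain x y where xy: "x \<in> B1'" "y \<in> B2'" "\<forall>j\<in>(L1 - S1) \<inter> (L2 - S2). x j \<noteq> y j"
        using elim(2) by blast
      have eq: "{i \<in> L1 \<inter> L2. x i = y i} = {}" using g(5)[OF xy(1,2)] xy(3) by blast
      have "card {i \<in> L1 \<inter> L2. x i = y i} = 0" unfolding eq by simp
      then show "\<exists>x\<in>B1. \<exists>y\<in>B2. card {i \<in> L1 \<inter> L2. x i = y i} = 0" using xy(1,2) g(1,2) by blast
    qed
  qed
  then show ?case by blast
next
  case (Suc s)
  obtain r N' where IH: "\<forall>\<^sub>F m in sequentially. \<forall>L1 L2 B1 B2. uncapturable_fibred m L1 r (Suc (Suc k)) B1 \<longrightarrow> uncapturable_fibred m L2 r (Suc (Suc k)) B2 \<longrightarrow>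
     real N' * ln m \<le> card (L1 \<inter> L2) \<longrightarrow> (\<exists>x\<in>B1. \<exists>y\<in>B2. card {i \<in> L1 \<inter> L2. x i = y i} = s)"
    using Suc.IH by blast
  have "0 < 1 / (2 * (real r + 1))" by simp
  from eventually_restrictable[OF this, of "Suc k"]
  obtain N'' where N'': "\<forall>\<^sub>F m in sequentially. \<forall>L1 L2 B1 B2. dense_global m L1 (Suc k) (2 / sqrt m) B1 \<longrightarrow>
     dense_global m L2 (Suc k) (2 / sqrt m) B2 \<longrightarrow> real N'' * ln m \<le> card (L1 \<inter> L2) \<longrightarrow>
     (\<exists>i\<in>L1 \<inter> L2. \<exists>a\<in>{1..m}. restrictable m L1 (1 / (2 * (real r + 1))) B1 i a \<and> restrictable m L2 (1 / (2 * (real r + 1))) B2 i a)"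
    by blast
  \<comment> \<open>\<open>N'\<close> serves the induction hypothesis and \<open>N''\<close> the
    search for \<open>i\<close>; \<open>4 * k\<close> pays for the coordinates fixed by
    \<open>globalize\<close> and 1 for \<open>i\<close> itself, using
    \<open>1 \<le> ln m\<close>.\<close>
  define N where "N = N' + N'' + 4 * k + 1"
  have "\<forall>\<^sub>F m in sequentially. 4 * real k \<le> sqrt (real m)" by real_asymp
  moreover have "\<forall>\<^sub>F m in sequentially. 1 \<le> ln (real m)" by real_asymp
  ultimately have "\<forall>\<^sub>F m in sequentially. \<forall>L1 L2 B1 B2. uncapturable_fibred m L1 (2 * k) k B1 \<longrightarrow> uncapturable_fibred m L2 (2 * k) k B2 \<longrightarrow>
     real N * ln m \<le> card (L1 \<inter> L2) \<longrightarrow> (\<exists>x\<in>B1. \<exists>y\<in>B2. card {i \<in> L1 \<inter> L2. x i = y i} = Suc s)"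
    using IH N'' eventually_gt_at_top[of "4::nat"]
  proof eventually_elim
    case (elim m)
    show ?case
    proof (intro allI impI)
      fix L1 L2 B1 B2 assume u: "uncapturable_fibred m L1 (2 * k) k B1" "uncapturable_fibred m L2 (2 * k) k B2"
        and big: "real N * ln m \<le> card (L1 \<inter> L2)"
      have m2: "2 \<le> m" using elim(5) by simp
      obtain S1 S2 B1' B2' where g: "S1 \<subseteq> L1" "S2 \<subseteq> L2" "card S1 \<le> 2 * k" "card S2 \<le> 2 * k" "B1' \<subseteq> B1" "B2' \<subseteq> B2"
        "dense_global m (L1 - S1) (Suc k) (2 / sqrt m) B1'" "dense_global m (L2 - S2) (Suc k) (2 / sqrt m) B2'"
        "\<And>x y i. x \<in> B1' \<Longrightarrow> y \<in> B2' \<Longrightarrow> i \<in> L1 \<inter> L2 \<Longrightarrow> i \<in> S1 \<union> S2 \<Longrightarrow> x i \<noteq> y i"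
        by (rule globalize[OF u order_refl m2 elim(1)]) (rule that)
      have fin: "finite L1" "finite L2" using u unfolding uncapturable_fibred_def fibred_def by auto
      define I where "I = (L1 - S1) \<inter> (L2 - S2)"
      have finI: "finite I" unfolding I_def using fin by simp
      have "card (L1 \<inter> L2) \<le> card I + 4 * k"
      proof -
        have "L1 \<inter> L2 \<subseteq> I \<union> (S1 \<union> S2)" unfolding I_def by auto
        then have "card (L1 \<inter> L2) \<le> card (I \<union> (S1 \<union> S2))"
          using finI g(1,2) fin by (intro card_mono) (auto intro: finite_subset)
        also have "\<dots> \<le> card I + (card S1 + card S2)"
          using card_Un_le[of I "S1 \<union> S2"] card_Un_le[of S1 S2] by linarith
        finally show ?thesis using g(3,4) by linarith
      qed
      then have 1: "real N * ln m \<le> real (card I) + 4 * real k" using big by linarith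
      have 2: "real N * ln m = real N' * ln m + real N'' * ln m + (4 * real k + 1) * ln m"
        unfolding N_def by (simp add: algebra_simps)
      have 3: "4 * real k + 1 \<le> (4 * real k + 1) * ln m"
        using elim(2) mult_left_mono[of 1 "ln m" "4 * real k + 1"] by simp
      have 4: "0 \<le> real N' * ln m" "0 \<le> real N'' * ln m" using elim(2) by auto
      have N1: "real N'' * ln m \<le> real (card I)" using 1 2 3 4 by linarith
      have N2: "real N' * ln m \<le> real (card I) - 1" using 1 2 3 4 by linarith
      obtain i a where ia: "i \<in> I" "restrictable m (L1 - S1) (1 / (2 * (real r + 1))) B1' i a"
        "restrictable m (L2 - S2) (1 / (2 * (real r + 1))) B2' i a"
        using elim(4)[rule_format, OF g(7,8)] N1 unfolding I_def by blast
      have I': "(L1 - S1 - {i}) \<inter> (L2 - S2 - {i}) = I - {i}" unfolding I_def by auto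
      have "uncapturable_fibred m (L1 - S1 - {i}) r (Suc (Suc k)) {y \<in> B1'. y i = a}"
        using ia(1) unfolding I_def by (intro restrictable_imp_uncapturable_fibred[OF g(7) _ ia(2) elim(5)]) auto
      moreover have "uncapturable_fibred m (L2 - S2 - {i}) r (Suc (Suc k)) {y \<in> B2'. y i = a}"
        using ia(1) unfolding I_def by (intro restrictable_imp_uncapturable_fibred[OF g(8) _ ia(3) elim(5)]) auto
      moreover have "real N' * ln m \<le> card (I - {i})"
        using N2 card_Suc_Diff1[OF finI ia(1)] by linarith
      ultimately obtain x y where xy: "x \<in> {y \<in> B1'. y i = a}" "y \<in> {y \<in> B2'. y i = a}"
        "card {j \<in> I - {i}. x j = y j} = s"
        using elim(3)[rule_format, of "L1 - S1 - {i}" "{y \<in> B1'. y i = a}" "L2 - S2 - {i}" "{y \<in> B2'. y i = a}"]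
        unfolding I' by blast
      have xB: "x \<in> B1'" "y \<in> B2'" "x i = y i" using xy(1,2) by auto
      \<comment> \<open>No agreement occurs on \<open>S1 \<union> S2\<close>, so the only one gained
        is at \<open>i\<close>.\<close>
      have "{j \<in> L1 \<inter> L2. x j = y j} = insert i {j \<in> I - {i}. x j = y j}"
        using g(9)[OF xB(1,2)] xB(3) ia(1) unfolding I_def by blast
      then have "card {j \<in> L1 \<inter> L2. x j = y j} = Suc s" using xy(3) finI by simp
      then show "\<exists>x\<in>B1. \<exists>y\<in>B2. card {i \<in> L1 \<inter> L2. x i = y i} = Suc s" using xB(1,2) g(5,6) by blast
    qed
  qed
  then show ?case by blast
qed

lemma uncapturable_imp_fibred:
  assumes "finite I" "0 < m" "A \<subseteq> cube m I" "uncapturable m I r (1 / real m ^ k) A"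
  shows "uncapturable_fibred m I r k A"
proof -
  have "inj_on (\<lambda>y. restrict y I) A"
  proof (rule inj_onI)
    fix x y assume "x \<in> A" "y \<in> A" "restrict x I = restrict y I"
    then show "x = y" using assms(3) unfolding cube_def by (metis PiE_restrict subsetD)
  qed
  moreover have "finite A" using finite_subset[OF assms(3)] assms(1) by simp
  moreover have "\<forall>y\<in>A. \<forall>i\<in>I. y i \<in> {1..m}" using assms(3) unfolding cube_def by blast
  ultimately have "fibred m I A" using assms(1) unfolding fibred_def by blast
  moreover have "real m ^ card I < real (card {y \<in> A. \<forall>(i, a)\<in>E. y i \<noteq> a}) * real m ^ k"
    if E: "E \<subseteq> I \<times> {1..m}" "card E \<le> r" for E
  proof -
    define D where "D = (\<lambda>(i, a). {x \<in> cube m I. x i = a}) ` E"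
    have finE: "finite E" using finite_subset[OF E(1)] assms(1) by simp
    have "card D \<le> r" using card_image_le[OF finE] E(2) unfolding D_def by (rule le_trans)
    moreover have "D \<subseteq> dictators m I" using E(1) unfolding D_def dictators_def by fastforce
    moreover have "finite D" using finE unfolding D_def by simp
    ultimately have "1 / real m ^ k < mu m I (A - \<Union>D)"
      using assms(4) unfolding uncapturable_def capturable_def by (meson not_le)
    moreover have "(A - \<Union>D) \<inter> cube m I = {y \<in> A. \<forall>(i, a)\<in>E. y i \<noteq> a}"
      using assms(3) unfolding D_def by auto
    ultimately show ?thesis
      using assms(1,2) unfolding mu_def by (simp add: card_cube field_simps)
  qed
  ultimately show ?thesis unfolding uncapturable_fibred_def by blast
qed

theorem theorem6p4:
  fixes s k :: nat
  shows "\<exists>r m0 N :: nat. \<forall>m n :: nat. \<forall>R1 R2 :: nat set.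
     \<forall>A1 A2 :: (nat \<Rightarrow> nat) set.
       m \<ge> m0 \<longrightarrow> real n \<ge> real N * ln (real m) \<longrightarrow>
       R1 \<subseteq> {1..n} \<longrightarrow> card R1 \<le> k \<longrightarrow>
       R2 \<subseteq> {1..n} \<longrightarrow> card R2 \<le> k \<longrightarrow>
       A1 \<subseteq> cube m ({1..n} - R1) \<longrightarrow>
       uncapturable m ({1..n} - R1) r (1 / real m ^ k) A1 \<longrightarrow>
       A2 \<subseteq> cube m ({1..n} - R2) \<longrightarrow>
       uncapturable m ({1..n} - R2) r (1 / real m ^ k) A2 \<longrightarrow>
       (\<exists>x1\<in>A1. \<exists>x2\<in>A2.
          card {i \<in> {1..n} - (R1 \<union> R2). x1 i = x2 i} = s)"
proof -
  obtain r N where main: "\<forall>\<^sub>F m in sequentially. \<forall>L1 L2 B1 B2. uncapturable_fibred m L1 r k B1 \<longrightarrow> uncapturable_fibred m L2 r k B2 \<longrightarrow>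
     real N * ln m \<le> card (L1 \<inter> L2) \<longrightarrow> (\<exists>x\<in>B1. \<exists>y\<in>B2. card {i \<in> L1 \<inter> L2. x i = y i} = s)"
    using eventually_agreement by blast
  have "\<forall>\<^sub>F m in sequentially. 1 \<le> ln (real m)" by real_asymp
  with main eventually_gt_at_top[of "0::nat"]
  have "\<forall>\<^sub>F m in sequentially. 0 < m \<and> 1 \<le> ln (real m) \<and>
    (\<forall>L1 L2 B1 B2. uncapturable_fibred m L1 r k B1 \<longrightarrow> uncapturable_fibred m L2 r k B2 \<longrightarrow>
     real N * ln m \<le> card (L1 \<inter> L2) \<longrightarrow> (\<exists>x\<in>B1. \<exists>y\<in>B2. card {i \<in> L1 \<inter> L2. x i = y i} = s))"
    by eventually_elim blast
  then obtain m0 where m0: "\<And>m. m0 \<le> m \<Longrightarrow> 0 < m" "\<And>m. m0 \<le> m \<Longrightarrow> 1 \<le> ln (real m)"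
    "\<And>m L1 L2 B1 B2. m0 \<le> m \<Longrightarrow> uncapturable_fibred m L1 r k B1 \<Longrightarrow> uncapturable_fibred m L2 r k B2 \<Longrightarrow>
     real N * ln m \<le> card (L1 \<inter> L2) \<Longrightarrow> (\<exists>x\<in>B1. \<exists>y\<in>B2. card {i \<in> L1 \<inter> L2. x i = y i} = s)"
    unfolding eventually_sequentially by blast
  show ?thesis
  proof (intro exI allI impI)
    fix m n :: nat and R1 R2 :: "nat set" and A1 A2 :: "(nat \<Rightarrow> nat) set"
    \<comment> \<open>The last witness is \<open>N + 2 * k\<close>: at most \<open>2 * k\<close>
      coordinates lie in \<open>R1 \<union> R2\<close>, and \<open>2 * k * ln m\<close> covers them
      because \<open>1 \<le> ln m\<close>.\<close>
    assume m: "m0 \<le> m" and n: "real (N + 2 * k) * ln (real m) \<le> real n"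
      and R: "R1 \<subseteq> {1..n}" "card R1 \<le> k" "R2 \<subseteq> {1..n}" "card R2 \<le> k"
      and A1: "A1 \<subseteq> cube m ({1..n} - R1)" "uncapturable m ({1..n} - R1) r (1 / real m ^ k) A1"
      and A2: "A2 \<subseteq> cube m ({1..n} - R2)" "uncapturable m ({1..n} - R2) r (1 / real m ^ k) A2"
    have eq: "({1..n} - R1) \<inter> ({1..n} - R2) = {1..n} - (R1 \<union> R2)" by auto
    have "n - card (R1 \<union> R2) \<le> card ({1..n} - (R1 \<union> R2))"
      using diff_card_le_card_Diff[of "R1 \<union> R2" "{1..n}"] R(1,3) finite_subset by auto
    moreover have "card (R1 \<union> R2) \<le> 2 * k" using card_Un_le[of R1 R2] R(2,4) by linarith
    ultimately have "real n \<le> real (card ({1..n} - (R1 \<union> R2))) + 2 * real k" by linarith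
    moreover have "2 * real k * 1 \<le> 2 * real k * ln m" using m0(2)[OF m] by (intro mult_left_mono) auto
    moreover have "real (N + 2 * k) * ln m = real N * ln m + 2 * real k * ln m" by (simp add: algebra_simps)
    ultimately have "real N * ln m \<le> card ({1..n} - (R1 \<union> R2))" using n by linarith
    moreover have "uncapturable_fibred m ({1..n} - R1) r k A1" "uncapturable_fibred m ({1..n} - R2) r k A2"
      using A1 A2 m0(1)[OF m] by (auto intro!: uncapturable_imp_fibred)
    ultimately show "\<exists>x1\<in>A1. \<exists>x2\<in>A2. card {i \<in> {1..n} - (R1 \<union> R2). x1 i = x2 i} = s"
      using m0(3)[OF m, of "{1..n} - R1" A1 "{1..n} - R2" A2] unfolding eq by blast
  qed
qed

end
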